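(* Let $(X,T)$ and $(Y,S)$ be shifts, where $(X,T)$ is a transitive shift of finite type. Then for every $f\in C(X\times Y)$ the functional $\psi_f:\mathcal{M}_S(Y)\to\mathbb{R}$ is continuous and affine. In particular, there exists an ergodic $\nu_0\in\partial_e\mathcal{M}_S(Y)$ which is $\alpha$-maximizing, i.e. $\psi_f(\nu_0)=\sup_{\nu\in\mathcal{M}_S(Y)}\psi_f(\nu)$.
   Context: For a finite alphabet $\mathcal{A}$ (discrete), $\mathcal{A}^{\mathbb{Z}}$ carries the product topology and left shift $(Tx)(j)=x(j+1)$. A shift is a nonempty compact $X\subseteq\mathcal{A}^{\mathbb{Z}}$ with $TX=X$; it is a shift of finite type if for some $M\in\mathbb{N}$ and $\mathcal{F}\subseteq\mathcal{A}^{\{0,\dots,M\}}$, $X=\{x:(T^jx)|_{[0,M]}\notin\mathcal{F}\ \forall j\in\mathbb{Z}\}$. A shift $X$ is transitive if there is $D\in\mathbb{N}$ such that for all $x_1,x_2\in X$ and integers $b_1,a_2$ with $a_2-b_1\ge D$ there is $x'\in X$ with $x'(j)=x_1(j)$ for $j\le b_1$ and $x'(j)=x_2(j)$ for $j\ge a_2$. $\mathcal{M}_S(Y)$ is the set of $S$-invariant Borel probability measures with the weak* topology, $\partial_e$ its extreme (ergodic) points. With $\pi_Y(x,y)=y$, $\psi_f(\nu)=\min\{\int f\,d\lambda:\lambda\in\mathcal{M}_{T\times S}(X\times Y),(\pi_Y)_*\lambda=\nu\}$ and $\alpha(f)=\sup_\nu\psi_f(\nu)$. *)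

theory Defs
  imports "HOL-Analysis.Analysis" "HOL-Probability.Probability"
begin

text \<open>Points of the full shift over alphabet 'a are maps int => 'a; the alphabet is a finite
  type with the discrete topology, and int => 'a carries the product topology.\<close>

definition shift :: "(int \<Rightarrow> 'a) \<Rightarrow> (int \<Rightarrow> 'a)" where
  "shift x = (\<lambda>j. x (j + 1))"

definition is_shift :: "(int \<Rightarrow> 'a::{finite,discrete_topology}) set \<Rightarrow> bool" where
  "is_shift X \<longleftrightarrow> X \<noteq> {} \<and> compact X \<and> shift ` X = X"

text \<open>Shift of finite type: forbidden words of length M+1 (lists); (T^j x)|[0,M] is the word
  x(j), ..., x(j+M).\<close>
definition is_sft :: "(int \<Rightarrow> 'a::{finite,discrete_topology}) set \<Rightarrow> bool" where
  "is_sft X \<longleftrightarrow> is_shift X \<and>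
     (\<exists>M::nat. \<exists>F. F \<subseteq> {w :: 'a list. length w = M + 1} \<and>
        X = {x. \<forall>j::int. map (\<lambda>i. x (j + int i)) [0..<M+1] \<notin> F})"

definition is_transitive :: "(int \<Rightarrow> 'a::{finite,discrete_topology}) set \<Rightarrow> bool" where
  "is_transitive X \<longleftrightarrow> is_shift X \<and>
     (\<exists>D::nat. \<forall>x1\<in>X. \<forall>x2\<in>X. \<forall>b1 a2::int. a2 - b1 \<ge> int D \<longrightarrow>
        (\<exists>x'\<in>X. (\<forall>j\<le>b1. x' j = x1 j) \<and> (\<forall>j\<ge>a2. x' j = x2 j)))"

text \<open>Invariant Borel probability measures on a closed set K, represented as Borel probability
  measures on the ambient space concentrated on K.\<close>
definition inv_measures :: "('x::topological_space \<Rightarrow> 'x) \<Rightarrow> 'x set \<Rightarrow> 'x measure set" where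
  "inv_measures S K = {M. sets M = sets borel \<and> prob_space M \<and> emeasure M K = 1 \<and>
                          distr M borel S = M}"

definition weakstar :: "'x::topological_space set \<Rightarrow> 'x measure topology" where
  "weakstar K = topology_generated_by
     {{M. (\<integral>x\<in>K. g x \<partial>M) \<in> U} | (g :: 'x \<Rightarrow> real) U. continuous_on K g \<and> open U}"

definition mix :: "real \<Rightarrow> 'x::topological_space measure \<Rightarrow> 'x measure \<Rightarrow> 'x measure" where
  "mix t \<mu> \<nu> = measure_of UNIV (sets borel)
      (\<lambda>A. ennreal t * emeasure \<mu> A + ennreal (1 - t) * emeasure \<nu> A)"

definition extreme_measure :: "'x::topological_space measure set \<Rightarrow> 'x measure \<Rightarrow> bool" where
  "extreme_measure P \<nu> \<longleftrightarrow> \<nu> \<in> P \<and>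
     (\<forall>\<mu>1\<in>P. \<forall>\<mu>2\<in>P. \<forall>t\<in>{0<..<1::real}. \<nu> = mix t \<mu>1 \<mu>2 \<longrightarrow> \<mu>1 = \<nu> \<and> \<mu>2 = \<nu>)"

definition affine_on_measures :: "'x::topological_space measure set \<Rightarrow> ('x measure \<Rightarrow> real) \<Rightarrow> bool" where
  "affine_on_measures P \<Psi> \<longleftrightarrow>
     (\<forall>\<mu>1\<in>P. \<forall>\<mu>2\<in>P. \<forall>t\<in>{0..1::real}. \<Psi> (mix t \<mu>1 \<mu>2) = t * \<Psi> \<mu>1 + (1 - t) * \<Psi> \<mu>2)"

definition psi ::
  "((int \<Rightarrow> 'a::{finite,discrete_topology}) \<times> (int \<Rightarrow> 'b::{finite,discrete_topology}) \<Rightarrow> real)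
   \<Rightarrow> (int \<Rightarrow> 'a) set \<Rightarrow> (int \<Rightarrow> 'b) set \<Rightarrow> (int \<Rightarrow> 'b) measure \<Rightarrow> real" where
  "psi f X Y \<nu> = Inf {(\<integral>z\<in>X \<times> Y. f z \<partial>L) | L.
      L \<in> inv_measures (\<lambda>(x, y). (shift x, shift y)) (X \<times> Y) \<and> distr L borel snd = \<nu>}"

end

theory Submission
  imports Defs
begin

text \<open>
  Fix a large block length n. Minimising the Birkhoff sum of f over n steps in the first variable gives
  a function of y which, up to a small error per step, equals n c for a locally constant function c.
  Integrating Birkhoff sums shows that \<open>psi \<nu> \<ge> \<integral>c d\<nu> - \<epsilon>\<close> for every invariant \<open>\<nu>\<close>. Conversely, transitivity and the finite type
  condition allow near-minimising blocks to be glued into a point G y of X, at a cost bounded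
  independently of n, in such a way that G commutes with the n-th power of the shift. Averaging
  the image of \<open>\<nu>\<close> under \<open>y \<mapsto> (G y, y)\<close> over n steps gives a lift of \<open>\<nu>\<close>, so \<open>psi \<nu> \<le> \<integral>c d\<nu> + \<epsilon>\<close>. Hence
  psi is a uniform limit of continuous affine functionals. An ergodic maximiser is found by
  maximising first psi and then, successively, the measures of all cylinders over the
  compact set of invariant measures.
\<close>

subsection \<open>Cylinders and the shift map\<close>

text \<open>The hard half is the upper bound on \<open>psi\<close>. Compactness of the set of lifts
  would by itself give only lower semicontinuity; upper semicontinuity needs almost optimal lifts of
  all nearby measures, and a good lift of one measure says nothing about another. A block code
  removes this dependence: it is chosen before \<open>\<nu>\<close> and serves all invariant
  measures at once, so the approximation is uniform in \<open>\<nu>\<close>. The price is that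
  blocks start at multiples of n, so that the code commutes only with the n-th power of the shift;
  hence the averaging.

  Coordinates beyond distance L change f by at most a small error, and gluing overwrites D positions
  per block. So at most 2 L + D of the n summands are spoiled, whatever n is.

  Compactness is not taken in the weak* topology. Invariant measures on a closed set correspond to
  invariant finitely additive set functions on the clopen sets, and these form a compact subset of a
  product of unit intervals. Cylinders are countable in number and determine a measure, so
  maximising along an enumeration of them settles extremality.\<close>

lemma closed_of_compact_fun:
  fixes S :: "('i \<Rightarrow> 'a::t2_space) set"
  assumes "compact S"
  shows "closed S"
proof -
  have "Hausdorff_space (product_topology (\<lambda>i::'i. euclidean :: 'a topology) UNIV)"
    unfolding Hausdorff_space_product_topology by (simp add: Hausdorff_space_def disjnt_def) (metis hausdorff)
  then have "closedin (product_topology (\<lambda>i::'i. euclidean :: 'a topology) UNIV) S"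
    by (rule compactin_imp_closedin) (simp add: euclidean_product_topology assms)
  then show ?thesis
    by (simp add: euclidean_product_topology)
qed

text \<open>Only windows centred at 0 are used. For fixed N they form a finite clopen partition, so
  a function of the coordinates in the window can be written \<open>c (cyl N y)\<close> with c
  defined on sets.\<close>

definition cyl :: "nat \<Rightarrow> (int \<Rightarrow> 'a) \<Rightarrow> (int \<Rightarrow> 'a) set" where
  "cyl N x = {y. \<forall>j. \<bar>j\<bar> \<le> int N \<longrightarrow> y j = x j}"

lemma self_in_cyl [simp]: "x \<in> cyl N x"
  by (simp add: cyl_def)

lemma cyl_antimono: "N \<le> N' \<Longrightarrow> cyl N' x \<subseteq> cyl N x"
  by (auto simp: cyl_def)

lemma cyl_cong: "y \<in> cyl N x \<Longrightarrow> cyl N y = cyl N x"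
  by (auto simp: cyl_def)

lemma cyl_subset: "y \<in> cyl N x \<Longrightarrow> N \<le> N' \<Longrightarrow> cyl N' y \<subseteq> cyl N x"
  using cyl_antimono cyl_cong by metis

lemma finite_range_cyl: "finite (range (cyl N :: (int \<Rightarrow> 'a::finite) \<Rightarrow> _))"
proof -
  have "cyl N x = cyl N (restrict x {-int N..int N})" for x :: "int \<Rightarrow> 'a"
    by (auto simp: cyl_def abs_le_iff)
  then have "cyl N x \<in> cyl N ` ({-int N..int N} \<rightarrow>\<^sub>E UNIV)" for x :: "int \<Rightarrow> 'a"
    by (rule image_eqI[where x = "restrict x {-int N..int N}"]) auto
  then have "range (cyl N :: (int \<Rightarrow> 'a) \<Rightarrow> _) \<subseteq> cyl N ` ({-int N..int N} \<rightarrow>\<^sub>E UNIV)"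
    by blast
  then show ?thesis
    by (rule finite_subset) (intro finite_imageI finite_PiE; simp)
qed

definition cylinders :: "(int \<Rightarrow> 'a) set set" where
  "cylinders = (\<Union>N. range (cyl N))"

lemma cyl_in_cylinders: "cyl N x \<in> cylinders"
  by (auto simp: cylinders_def)

lemma countable_cylinders: "countable (cylinders :: (int \<Rightarrow> 'a::finite) set set)"
  unfolding cylinders_def
  by (intro countable_UN countable_finite finite_range_cyl countableI_type)

lemma open_vimage_coordinate:
  fixes A :: "'a::discrete_topology set"
  shows "open {y :: int \<Rightarrow> 'a. y j \<in> A}"
proof -
  have "continuous_on UNIV (\<lambda>y :: int \<Rightarrow> 'a. y j)"
    by (rule continuous_on_product_coordinates)
  then have "open ((\<lambda>y :: int \<Rightarrow> 'a. y j) -` A)"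
    by (intro open_vimage discrete_topology_class.open_discrete)
  then show ?thesis
    by (simp add: vimage_def)
qed

lemma open_cyl: "open (cyl N (x :: int \<Rightarrow> 'a::discrete_topology))"
proof -
  have "cyl N x = (\<Inter>j\<in>{-int N..int N}. {y. y j \<in> {x j}})"
    by (auto simp: cyl_def abs_le_iff)
  then show ?thesis
    using open_vimage_coordinate[of _ "{x _}"] by (auto intro!: open_INT)
qed

lemma closed_cyl: "closed (cyl N (x :: int \<Rightarrow> 'a::discrete_topology))"
proof -
  have "- cyl N x = (\<Union>y\<in>- cyl N x. cyl N y)"
    by (auto simp: cyl_def)
  then show ?thesis
    unfolding closed_def by (metis open_UN open_cyl)
qed

lemma open_contains_cyl:
  fixes x :: "int \<Rightarrow> 'a::discrete_topology"
  assumes "open U" "x \<in> U"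
  obtains N where "cyl N x \<subseteq> U"
proof -
  have "openin (product_topology (\<lambda>i. euclidean) UNIV) U"
    using assms by (simp add: euclidean_product_topology)
  from product_topology_open_contains_basis[OF this \<open>x \<in> U\<close>]
  obtain W where W: "x \<in> (\<Pi>\<^sub>E i\<in>UNIV. W i)" "finite {i. W i \<noteq> UNIV}" "(\<Pi>\<^sub>E i\<in>UNIV. W i) \<subseteq> U"
    by auto
  obtain N where N: "\<And>i. W i \<noteq> UNIV \<Longrightarrow> nat \<bar>i\<bar> \<le> N"
    using finite_nat_set_iff_bounded_le[THEN iffD1, OF finite_imageI[OF W(2), of "\<lambda>i. nat \<bar>i\<bar>"]]
    by auto
  have "cyl N x \<subseteq> U"
  proof
    fix y assume y: "y \<in> cyl N x"
    have "y i \<in> W i" for i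
    proof (cases "W i = UNIV")
      case False
      then have "y i = x i" using N[of i] y by (auto simp: cyl_def)
      then show ?thesis using W(1) by auto
    qed auto
    then show "y \<in> U" using W(3) by auto
  qed
  then show ?thesis using that by blast
qed

lemma open_eq_Union_cylinders:
  fixes U :: "(int \<Rightarrow> 'a::discrete_topology) set"
  assumes "open U"
  shows "U = \<Union>{C \<in> cylinders. C \<subseteq> U}"
proof -
  have "\<exists>C\<in>cylinders. x \<in> C \<and> C \<subseteq> U" if "x \<in> U" for x
    using open_contains_cyl[OF assms that] cyl_in_cylinders self_in_cyl by metis
  then show ?thesis by blast
qed

text \<open>Countability of the cylinders turns the union representing an open set into a countable
  one. The empty set is adjoined to make the generator stable under intersections.\<close>

lemma sets_borel_cylinders:
  "sets (borel :: (int \<Rightarrow> 'a::{finite,discrete_topology}) measure) = sigma_sets UNIV (insert {} cylinders)"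
proof
  have "sigma_sets UNIV {U :: (int \<Rightarrow> 'a) set. open U} \<subseteq> sigma_sets UNIV (insert {} cylinders)"
  proof (rule sigma_sets_mono, rule)
    fix U :: "(int \<Rightarrow> 'a) set" assume "U \<in> {U. open U}"
    then have "U = \<Union>{C \<in> cylinders. C \<subseteq> U}" using open_eq_Union_cylinders by auto
    also have "\<dots> \<in> sigma_sets UNIV (insert {} cylinders)"
    proof (rule sigma_algebra.countable_Union[OF sigma_algebra_sigma_sets])
      show "countable {C \<in> cylinders. C \<subseteq> U}"
        by (rule countable_subset[OF _ countable_cylinders]) auto
    qed auto
    finally show "U \<in> sigma_sets UNIV (insert {} cylinders)" .
  qed
  then show "sets (borel :: (int \<Rightarrow> 'a) measure) \<subseteq> sigma_sets UNIV (insert {} cylinders)"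
    by (simp add: borel_def)
  have "insert {} cylinders \<subseteq> sets (borel :: (int \<Rightarrow> 'a) measure)"
    by (auto simp: cylinders_def open_cyl)
  then show "sigma_sets UNIV (insert {} cylinders) \<subseteq> sets (borel :: (int \<Rightarrow> 'a) measure)"
    using sets.sigma_sets_subset[of "insert {} cylinders" "borel :: (int \<Rightarrow> 'a) measure"] by simp
qed

text \<open>Two centred cylinders are either disjoint or nested.\<close>

lemma Int_stable_cylinders: "Int_stable (insert {} cylinders)"
proof (rule Int_stableI)
  have *: "cyl N x \<inter> cyl N' y \<in> insert {} cylinders" if "N \<le> N'" for N N' and x y :: "int \<Rightarrow> 'a"
  proof (cases "cyl N x \<inter> cyl N' y = {}")
    case False
    then obtain z where z: "z \<in> cyl N x" "z \<in> cyl N' y" by auto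
    then have "cyl N x \<inter> cyl N' y = cyl N' z"
      using cyl_cong[OF z(1)] cyl_cong[OF z(2)] cyl_antimono[OF that, of z] by auto
    then show ?thesis by (simp add: cyl_in_cylinders)
  qed auto
  fix A B :: "(int \<Rightarrow> 'a) set" assume "A \<in> insert {} cylinders" "B \<in> insert {} cylinders"
  then consider "A = {} \<or> B = {}" | N x N' y where "A = cyl N x" "B = cyl N' y"
    by (auto simp: cylinders_def)
  then show "A \<inter> B \<in> insert {} cylinders"
  proof cases
    case 2 then show ?thesis using *[of N N' x y] *[of N' N y x] by (cases "N \<le> N'") (auto simp: Int_commute)
  qed auto
qed

lemma measure_eqI_cylinders:
  fixes \<mu> \<nu> :: "(int \<Rightarrow> 'a::{finite,discrete_topology}) measure"
  assumes "sets \<mu> = sets borel" "sets \<nu> = sets borel" "prob_space \<mu>" "prob_space \<nu>"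
    and eq: "\<And>C. C \<in> cylinders \<Longrightarrow> measure \<mu> C = measure \<nu> C"
  shows "\<mu> = \<nu>"
proof (rule measure_eqI_generator_eq_countable[OF Int_stable_cylinders, where \<Omega> = UNIV and A = cylinders])
  interpret \<mu>: prob_space \<mu> by fact
  interpret \<nu>: prob_space \<nu> by fact
  show "emeasure \<mu> C = emeasure \<nu> C" if "C \<in> insert {} cylinders" for C
    using that eq by (auto simp: \<mu>.emeasure_eq_measure \<nu>.emeasure_eq_measure)
  show "\<Union>cylinders = (UNIV :: (int \<Rightarrow> 'a) set)" using cyl_in_cylinders self_in_cyl by blast
  show "emeasure \<mu> C \<noteq> \<infinity>" for C by simp
qed (use assms sets_borel_cylinders countable_cylinders in auto)

lemma compact_fullshift: "compact (UNIV :: (int \<Rightarrow> 'a::{finite,discrete_topology}) set)"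
proof -
  have "compactin (product_topology (\<lambda>i::int. euclidean :: 'a topology) UNIV) (PiE UNIV (\<lambda>_. UNIV))"
    unfolding compactin_PiE by (simp add: finite_imp_compact)
  then show ?thesis by (simp add: euclidean_product_topology)
qed

lemma continuous_on_shift: "continuous_on A (shift :: (int \<Rightarrow> 'a::topological_space) \<Rightarrow> _)"
  unfolding shift_def
  by (intro continuous_on_coordinatewise_then_product
      continuous_on_subset[OF continuous_on_product_coordinates]) auto

lemma shift_funpow: "(shift ^^ i) x = (\<lambda>j. x (j + int i))"
  by (induction i) (auto simp: shift_def algebra_simps)

lemma inj_shift: "inj shift"
proof (rule injI)
  fix x y :: "int \<Rightarrow> 'a" assume "shift x = shift y"
  then have "x (j - 1 + 1) = y (j - 1 + 1)" for j unfolding shift_def by metis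
  then show "x = y" by auto
qed

lemma shift_mem_iff:
  assumes "shift ` X = X"
  shows "shift x \<in> X \<longleftrightarrow> x \<in> X"
  using assms inj_shift by (metis imageI inj_image_mem_iff)

lemma shift_funpow_mem:
  assumes "shift ` X = X" "x \<in> X"
  shows "(shift ^^ i) x \<in> X"
  using assms by (induction i) auto

lemma shift_int_mem:
  assumes "shift ` X = X" "x \<in> X"
  shows "(\<lambda>j. x (j + k)) \<in> X"
proof (cases "k \<ge> 0")
  case True
  then show ?thesis using shift_funpow_mem[OF assms, of "nat k"] by (simp add: shift_funpow)
next
  case False
  \<comment> \<open>The shift is injective and maps X onto itself, so it also reflects membership.
    Applied to a backward translate, its power leads back to x.\<close>
  have *: "(shift ^^ i) z \<in> X \<longleftrightarrow> z \<in> X" for i z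
    by (induction i) (auto simp: shift_mem_iff[OF assms(1)])
  show ?thesis using *[of "nat (-k)" "\<lambda>j. x (j + k)"] False assms(2) by (simp add: shift_funpow)
qed

subsection \<open>Mixtures, extreme points and contents on clopen sets\<close>

lemma sets_mix [simp, measurable_cong]: "sets (mix t \<mu> \<nu>) = sets borel"
  unfolding mix_def by (simp add: sets.sigma_sets_eq[of borel, simplified])

lemma space_mix [simp]: "space (mix t \<mu> \<nu>) = UNIV"
  using sets_eq_imp_space_eq[OF sets_mix] by simp

lemma emeasure_mix:
  assumes "sets \<mu> = sets borel" "sets \<nu> = sets borel" "A \<in> sets borel"
  shows "emeasure (mix t \<mu> \<nu>) A = ennreal t * emeasure \<mu> A + ennreal (1 - t) * emeasure \<nu> A"
proof (rule emeasure_measure_of[OF mix_def])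
  show "positive (sets (mix t \<mu> \<nu>)) (\<lambda>A. ennreal t * emeasure \<mu> A + ennreal (1 - t) * emeasure \<nu> A)"
    by (simp add: positive_def)
  show "countably_additive (sets (mix t \<mu> \<nu>))
          (\<lambda>A. ennreal t * emeasure \<mu> A + ennreal (1 - t) * emeasure \<nu> A)"
  proof (rule countably_additiveI)
    fix A :: "nat \<Rightarrow> 'a set"
    assume A: "range A \<subseteq> sets (mix t \<mu> \<nu>)" "disjoint_family A"
    have "(\<Sum>i. ennreal t * emeasure \<mu> (A i) + ennreal (1 - t) * emeasure \<nu> (A i)) =
          ennreal t * (\<Sum>i. emeasure \<mu> (A i)) + ennreal (1 - t) * (\<Sum>i. emeasure \<nu> (A i))"
      by (simp add: suminf_add[symmetric] ennreal_suminf_cmult)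
    then show "(\<Sum>i. ennreal t * emeasure \<mu> (A i) + ennreal (1 - t) * emeasure \<nu> (A i)) =
          ennreal t * emeasure \<mu> (\<Union>i. A i) + ennreal (1 - t) * emeasure \<nu> (\<Union>i. A i)"
      using A assms by (simp add: suminf_emeasure)
  qed
qed (use assms in auto)

lemma measure_mix:
  assumes "sets \<mu> = sets borel" "sets \<nu> = sets borel" "A \<in> sets borel"
    and "prob_space \<mu>" "prob_space \<nu>" "t \<in> {0..1}"
  shows "measure (mix t \<mu> \<nu>) A = t * measure \<mu> A + (1 - t) * measure \<nu> A"
proof -
  interpret \<mu>: prob_space \<mu> by fact
  interpret \<nu>: prob_space \<nu> by fact
  have "emeasure (mix t \<mu> \<nu>) A = ennreal (t * measure \<mu> A + (1 - t) * measure \<nu> A)"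
    using assms(6) unfolding emeasure_mix[OF assms(1-3)] \<mu>.emeasure_eq_measure \<nu>.emeasure_eq_measure
    by (simp add: ennreal_mult)
  then show ?thesis
    using assms(6) by (intro measure_eq_emeasure_eq_ennreal) auto
qed

lemma mix_in_inv_measures:
  assumes \<mu>: "\<mu> \<in> inv_measures S K" and \<nu>: "\<nu> \<in> inv_measures S K" and t: "t \<in> {0..1}"
    and K: "K \<in> sets borel" and [measurable]: "S \<in> borel \<rightarrow>\<^sub>M borel"
  shows "mix t \<mu> \<nu> \<in> inv_measures S K"
proof -
  have s [simp, measurable_cong]: "sets \<mu> = sets borel" "sets \<nu> = sets borel"
    and p: "prob_space \<mu>" "prob_space \<nu>" and K1: "emeasure \<mu> K = 1" "emeasure \<nu> K = 1"
    and inv: "distr \<mu> borel S = \<mu>" "distr \<nu> borel S = \<nu>"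
    using \<mu> \<nu> by (auto simp: inv_measures_def)
  have one: "ennreal t + ennreal (1 - t) = 1"
    using t by (simp add: ennreal_plus[symmetric] del: ennreal_plus)
  have sp: "space \<mu> = UNIV" "space \<nu> = UNIV"
    using sets_eq_imp_space_eq[OF s(1)] sets_eq_imp_space_eq[OF s(2)] by auto
  have "emeasure (mix t \<mu> \<nu>) UNIV = 1"
    using prob_space.emeasure_space_1[OF p(1)] prob_space.emeasure_space_1[OF p(2)] one
    by (simp add: emeasure_mix sp)
  then have "prob_space (mix t \<mu> \<nu>)" by (intro prob_spaceI) simp
  moreover have "emeasure (mix t \<mu> \<nu>) K = 1" using K K1 one by (simp add: emeasure_mix)
  moreover have "distr (mix t \<mu> \<nu>) borel S = mix t \<mu> \<nu>"
  proof (rule measure_eqI)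
    fix A assume "A \<in> sets (distr (mix t \<mu> \<nu>) borel S)"
    then have A [measurable]: "A \<in> sets borel" by simp
    have "S -` A \<in> sets borel" using measurable_sets[of S borel borel A] by simp
    moreover have "emeasure \<mu> (S -` A) = emeasure \<mu> A"
      using arg_cong[OF inv(1), of "\<lambda>M. emeasure M A"] by (simp add: emeasure_distr sp)
    moreover have "emeasure \<nu> (S -` A) = emeasure \<nu> A"
      using arg_cong[OF inv(2), of "\<lambda>M. emeasure M A"] by (simp add: emeasure_distr sp)
    ultimately show "emeasure (distr (mix t \<mu> \<nu>) borel S) A = emeasure (mix t \<mu> \<nu>) A"
      by (simp add: emeasure_distr emeasure_mix)
  qed simp
  ultimately show ?thesis by (simp add: inv_measures_def)
qed

section \<open>Nested compact sets and successive maximisation\<close>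

text \<open>Cantor's intersection theorem, with closedness assumed rather than derived from a
  separation axiom, so that it applies alike to sets of sequences, to sets of contents and to the
  abstract space of \<open>lexicographic_maximum\<close>.\<close>

lemma compact_nest_closed:
  fixes F :: "nat \<Rightarrow> 'a::topological_space set"
  assumes "compact (F 0)" and F: "\<And>n. closed (F n)" "\<And>n. F n \<noteq> {}" and mono: "\<And>n. F (Suc n) \<subseteq> F n"
  shows "(\<Inter>n. F n) \<noteq> {}"
proof -
  have dec: "F n \<subseteq> F m" if "m \<le> n" for m n
    using lift_Suc_antimono_le[of F, OF mono that] .
  have "F 0 \<inter> (\<Inter>n\<in>UNIV. F n) \<noteq> {}"
  proof (rule compact_imp_fip_image[OF assms(1) F(1)])
    fix I :: "nat set" assume "finite I"
    then obtain m where "\<forall>i\<in>I. i \<le> m" using finite_nat_set_iff_bounded_le by blast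
    then have "F m \<subseteq> F 0 \<inter> (\<Inter>n\<in>I. F n)" using dec by auto
    then show "F 0 \<inter> (\<Inter>n\<in>I. F n) \<noteq> {}" using F(2)[of m] by blast
  qed
  then show ?thesis by auto
qed

text \<open>This is what makes the set of maximisers of an affine function a face.\<close>

lemma convex_combination_max:
  fixes x y m t :: real
  assumes "m = t * x + (1 - t) * y" "x \<le> m" "y \<le> m" "0 < t" "t < 1"
  shows "x = m" "y = m"
proof -
  have "t * (m - x) + (1 - t) * (m - y) = 0" using assms(1) by (simp add: algebra_simps)
  moreover have "t * (m - x) \<ge> 0" "(1 - t) * (m - y) \<ge> 0" using assms by simp_all
  ultimately have "t * (m - x) = 0" "(1 - t) * (m - y) = 0" by linarith+
  then show "x = m" "y = m" using assms by auto
qed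

text \<open>Maximising the functions one after the other yields nested compact faces; a point common to
  all of them is extreme as far as these functions can tell.\<close>
lemma lexicographic_maximum:
  fixes Q :: "'q::topological_space set" and \<phi> :: "nat \<Rightarrow> 'q \<Rightarrow> real"
  assumes Q: "compact Q" "closed Q" "Q \<noteq> {}" and cont: "\<And>n. continuous_on Q (\<phi> n)"
  obtains q where "q \<in> Q" "\<And>r. r \<in> Q \<Longrightarrow> \<phi> 0 r \<le> \<phi> 0 q"
    "\<And>a b t n. a \<in> Q \<Longrightarrow> b \<in> Q \<Longrightarrow> 0 < t \<Longrightarrow> t < 1 \<Longrightarrow>
       (\<And>n. \<phi> n q = t * \<phi> n a + (1 - t) * \<phi> n b) \<Longrightarrow> \<phi> n a = \<phi> n q \<and> \<phi> n b = \<phi> n q"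
proof -
  define F where "F = rec_nat Q (\<lambda>n K. {q \<in> K. \<forall>r\<in>K. \<phi> n r \<le> \<phi> n q})"
  have F0: "F 0 = Q" and FS: "F (Suc n) = {q \<in> F n. \<forall>r\<in>F n. \<phi> n r \<le> \<phi> n q}" for n
    by (simp_all add: F_def)
  have F: "closed (F n) \<and> F n \<noteq> {} \<and> F n \<subseteq> Q" for n
  proof (induction n)
    case (Suc n)
    have c: "continuous_on (F n) (\<phi> n)" using Suc cont continuous_on_subset by blast
    have "compact (F n)" using compact_Int_closed[OF Q(1), of "F n"] Suc by (simp add: Int_absorb1)
    then obtain m where m: "m \<in> F n" "\<forall>r\<in>F n. \<phi> n r \<le> \<phi> n m"
      using continuous_attains_sup[OF _ _ c] Suc by blast
    then have eq: "F (Suc n) = F n \<inter> \<phi> n -` {\<phi> n m..}"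
      unfolding FS by (auto intro: order_trans)
    have "closed (F n \<inter> \<phi> n -` {\<phi> n m..})"
      by (rule continuous_closed_preimage[OF c]) (use Suc in auto)
    then show ?case using m Suc eq by auto
  qed (use Q F0 in auto)
  have "(\<Inter>n. F n) \<noteq> {}"
    by (rule compact_nest_closed) (use F F0 Q(1) in \<open>auto simp: FS\<close>)
  then obtain q where q: "\<And>n. q \<in> F n" by auto
  show ?thesis
  proof (rule that)
    show "q \<in> Q" using q[of 0] F0 by simp
    show "\<phi> 0 r \<le> \<phi> 0 q" if "r \<in> Q" for r using q[of "Suc 0"] that by (simp add: FS F0)
    fix a b t n assume ab: "a \<in> Q" "b \<in> Q" and t: "0 < t" "t < 1"
      and eq: "\<And>n. \<phi> n q = t * \<phi> n a + (1 - t) * \<phi> n b"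
    \<comment> \<open>The space carries no linear structure: that q lies between a and b is
      expressed only through the values of all the functions. Equality with the maximum at stage k
      is then what keeps a and b in the next face.\<close>
    have ext: "\<phi> k a = \<phi> k q \<and> \<phi> k b = \<phi> k q" if "a \<in> F k" "b \<in> F k" for k
    proof -
      have "\<phi> k a \<le> \<phi> k q" "\<phi> k b \<le> \<phi> k q" using q[of "Suc k"] that by (auto simp: FS)
      from convex_combination_max[OF eq this t] show ?thesis by simp
    qed
    have "a \<in> F k \<and> b \<in> F k" for k
    proof (induction k)
      case (Suc k)
      then show ?case using ext[of k] q[of "Suc k"] by (auto simp: FS)
    qed (use ab F0 in auto)
    then show "\<phi> n a = \<phi> n q \<and> \<phi> n b = \<phi> n q" using ext by blast
  qed
qed

section \<open>From finitely additive contents on clopen sets to Borel measures\<close>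

definition clopen :: "'a::topological_space set \<Rightarrow> bool" where
  "clopen C \<longleftrightarrow> open C \<and> closed C"

lemma clopen_simps [simp]:
  "clopen {}" "clopen UNIV" "clopen A \<Longrightarrow> clopen B \<Longrightarrow> clopen (A \<union> B)"
  "clopen A \<Longrightarrow> clopen B \<Longrightarrow> clopen (A - B)" "clopen A \<Longrightarrow> A \<in> sets borel"
  by (auto simp: clopen_def)

lemma clopen_cylinder: "C \<in> cylinders \<Longrightarrow> clopen (C :: (int \<Rightarrow> 'a::discrete_topology) set)"
  by (auto simp: cylinders_def clopen_def open_cyl closed_cyl)

lemma clopen_vimage_shift [simp]: "clopen C \<Longrightarrow> clopen (shift -` (C :: (int \<Rightarrow> 'a::topological_space) set))"
  by (simp add: clopen_def open_vimage closed_vimage continuous_on_shift)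

text \<open>On a compact space a decreasing sequence of clopen sets with empty intersection is
  eventually empty, so finite additivity on the clopen sets already gives countable additivity.\<close>
lemma measure_from_clopen_content:
  fixes q :: "(int \<Rightarrow> 'a::{finite,discrete_topology}) set \<Rightarrow> real"
  assumes nonneg: "\<And>C. 0 \<le> q C" and one: "q UNIV = 1"
    and add: "\<And>A B. clopen A \<Longrightarrow> clopen B \<Longrightarrow> A \<inter> B = {} \<Longrightarrow> q (A \<union> B) = q A + q B"
  obtains \<mu> where "sets \<mu> = sets borel" "prob_space \<mu>" "\<And>C. clopen C \<Longrightarrow> measure \<mu> C = q C"
proof -
  let ?C = "{C :: (int \<Rightarrow> 'a) set. clopen C}"
  have empty: "q {} = 0" using add[of "{}" "{}"] by simp
  have ring: "ring_of_sets UNIV ?C" by (rule ring_of_setsI) auto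
  have "\<exists>\<mu> :: (int \<Rightarrow> 'a) set \<Rightarrow> ennreal. (\<forall>s\<in>?C. \<mu> s = ennreal (q s)) \<and> measure_space UNIV (sigma_sets UNIV ?C) \<mu>"
  proof (rule ring_of_sets.caratheodory_empty_continuous[OF ring])
    show "positive ?C (\<lambda>C. ennreal (q C))" by (simp add: positive_def empty)
    show "additive ?C (\<lambda>C. ennreal (q C))"
      using add nonneg by (auto simp: additive_def ennreal_plus[symmetric] simp del: ennreal_plus)
    fix A :: "nat \<Rightarrow> (int \<Rightarrow> 'a) set"
    assume A: "range A \<subseteq> ?C" "decseq A" "(\<Inter>i. A i) = {}"
    have "\<exists>n. A n = {}"
    proof (rule ccontr)
      assume ne: "\<nexists>n. A n = {}"
      have "compact (A 0)"
        using A(1) compact_Int_closed[OF compact_fullshift, of "A 0"] by (auto simp: clopen_def)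
      then have "(\<Inter>i. A i) \<noteq> {}"
        by (rule compact_nest_closed) (use A(1,2) ne in \<open>auto simp: decseq_Suc_iff clopen_def\<close>)
      with A(3) show False by simp
    qed
    then obtain n where "A n = {}" by auto
    then have "A i = {}" if "i \<ge> n" for i using A(2) that by (auto simp: decseq_def)
    then have "eventually (\<lambda>i. ennreal (q (A i)) = 0) sequentially"
      using empty unfolding eventually_sequentially by (intro exI[of _ n]) auto
    then show "(\<lambda>i. ennreal (q (A i))) \<longlonglongrightarrow> 0" by (rule tendsto_eventually)
  qed auto
  then obtain m :: "(int \<Rightarrow> 'a) set \<Rightarrow> ennreal"
    where m: "\<And>C. clopen C \<Longrightarrow> m C = ennreal (q C)" "measure_space UNIV (sigma_sets UNIV ?C) m" by auto
  have sig: "sigma_sets UNIV ?C = sets borel"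
  proof
    have "?C \<subseteq> sets borel" by auto
    then show "sigma_sets UNIV ?C \<subseteq> sets borel"
      using sets.sigma_sets_subset[of ?C "borel :: (int \<Rightarrow> 'a) measure"] by simp
    show "sets borel \<subseteq> sigma_sets UNIV ?C"
      unfolding sets_borel_cylinders
      by (rule sigma_sets_mono') (auto simp: clopen_cylinder)
  qed
  define \<mu> where "\<mu> = measure_of UNIV (sets borel) m"
  have sets: "sets \<mu> = sets borel" unfolding \<mu>_def by (simp add: sets.sigma_sets_eq[of borel, simplified])
  have em: "emeasure \<mu> A = m A" if "A \<in> sets borel" for A
  proof (rule emeasure_measure_of[OF \<mu>_def])
    show "positive (sets \<mu>) m" "countably_additive (sets \<mu>) m"
      using m(2) by (auto simp: measure_space_def sig sets)
  qed (use that sets in auto)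
  have "prob_space \<mu>"
    using em[of UNIV] m(1)[of UNIV] one sets_eq_imp_space_eq[OF sets] by (intro prob_spaceI) simp
  moreover have "measure \<mu> C = q C" if "clopen C" for C
    using em[of C] m(1)[OF that] that nonneg by (simp add: measure_def)
  ultimately show ?thesis using that sets by blast
qed

subsection \<open>Compactness of the set of invariant measures\<close>

text \<open>The default value 0 off the clopen sets makes contents total functions on all sets,
  hence points of a full product space, and lets two contents be compared by plain equality.\<close>

definition clopen_content :: "'x::topological_space measure \<Rightarrow> 'x set \<Rightarrow> real" where
  "clopen_content \<mu> C = (if clopen C then measure \<mu> C else 0)"

text \<open>Every clause is a family of closed conditions on finitely many coordinates of q, which
  yields closedness, and the bounds put q into a cube that is compact by Tychonoff. The last clause
  encodes concentration on K: the complement of a closed K is a countable union of cylinders that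
  miss K.\<close>

definition contents :: "(int \<Rightarrow> 'a::topological_space) set \<Rightarrow> ((int \<Rightarrow> 'a) set \<Rightarrow> real) set" where
  "contents K = {q. (\<forall>C. 0 \<le> q C \<and> q C \<le> 1) \<and> (\<forall>C. \<not> clopen C \<longrightarrow> q C = 0) \<and> q UNIV = 1 \<and>
     (\<forall>A B. clopen A \<and> clopen B \<and> A \<inter> B = {} \<longrightarrow> q (A \<union> B) = q A + q B) \<and>
     (\<forall>C. clopen C \<and> C \<inter> K = {} \<longrightarrow> q C = 0)}"

definition inv_contents :: "(int \<Rightarrow> 'a::topological_space) set \<Rightarrow> ((int \<Rightarrow> 'a) set \<Rightarrow> real) set" where
  "inv_contents K = {q \<in> contents K. \<forall>C. clopen C \<longrightarrow> q (shift -` C) = q C}"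

lemma closed_contents: "closed (contents K)"
  unfolding contents_def
  by (intro closed_Collect_conj closed_Collect_all closed_Collect_imp closed_Collect_le
      closed_Collect_eq open_Collect_const continuous_on_const continuous_on_add
      continuous_on_product_coordinates)

lemma compact_contents: "compact (contents K)"
proof -
  have "compactin (product_topology (\<lambda>_. euclidean) UNIV) (PiE UNIV (\<lambda>_ :: (int \<Rightarrow> 'a) set. {0..1::real}))"
    unfolding compactin_PiE by simp
  then have "compact (PiE UNIV (\<lambda>_ :: (int \<Rightarrow> 'a) set. {0..1::real}) \<inter> contents K)"
    by (intro compact_Int_closed closed_contents) (simp add: euclidean_product_topology)
  moreover have "contents K \<subseteq> PiE UNIV (\<lambda>_. {0..1})" by (auto simp: contents_def)
  ultimately show ?thesis by (simp add: Int_absorb1)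
qed

lemma closed_inv_contents: "closed (inv_contents K)"
proof -
  have "inv_contents K = contents K \<inter> {q. \<forall>C. clopen C \<longrightarrow> q (shift -` C) = q C}"
    by (auto simp: inv_contents_def)
  also have "closed \<dots>"
    by (intro closed_Int closed_contents closed_Collect_all closed_Collect_imp open_Collect_const
        closed_Collect_eq continuous_on_product_coordinates)
  finally show ?thesis .
qed

lemma compact_inv_contents: "compact (inv_contents K)"
proof -
  have "contents K \<inter> inv_contents K = inv_contents K" by (auto simp: inv_contents_def)
  then show ?thesis using compact_Int_closed[OF compact_contents[of K] closed_inv_contents[of K]] by simp
qed

lemma inv_measuresD:
  assumes "\<mu> \<in> inv_measures S K"
  shows "sets \<mu> = sets borel" "space \<mu> = UNIV" "prob_space \<mu>" "emeasure \<mu> K = 1" "distr \<mu> borel S = \<mu>"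
  using assms sets_eq_imp_space_eq[of \<mu> borel] by (auto simp: inv_measures_def)

lemma inv_measures_vimage:
  assumes \<mu>: "\<mu> \<in> inv_measures S K" and S: "S \<in> borel \<rightarrow>\<^sub>M borel" and A: "A \<in> sets borel"
  shows "emeasure \<mu> (S -` A) = emeasure \<mu> A"
proof -
  have "S \<in> \<mu> \<rightarrow>\<^sub>M borel" using S measurable_cong_sets[OF inv_measuresD(1)[OF \<mu>] refl] by blast
  then have "emeasure (distr \<mu> borel S) A = emeasure \<mu> (S -` A)"
    using A by (simp add: emeasure_distr inv_measuresD(2)[OF \<mu>])
  then show ?thesis by (simp add: inv_measuresD(5)[OF \<mu>])
qed

lemma borel_measurable_shift [measurable]:
  "shift \<in> borel \<rightarrow>\<^sub>M (borel :: (int \<Rightarrow> 'a::topological_space) measure)"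
  by (intro borel_measurable_continuous_onI continuous_on_shift)

lemma clopen_content_in_inv_contents:
  fixes K :: "(int \<Rightarrow> 'a::topological_space) set"
  assumes \<mu>: "\<mu> \<in> inv_measures shift K" and K: "closed K"
  shows "clopen_content \<mu> \<in> inv_contents K"
proof -
  interpret prob_space \<mu> by (rule inv_measuresD(3)[OF \<mu>])
  note [simp] = inv_measuresD(1,2)[OF \<mu>]
  have K1: "prob K = 1" using inv_measuresD(4)[OF \<mu>] by (simp add: measure_def)
  have "prob C = 0" if "clopen C" "C \<inter> K = {}" for C
  proof -
    have "prob C + prob K = prob (C \<union> K)"
      using that K by (intro finite_measure_Union[symmetric]) auto
    then show ?thesis using K1 prob_le_1[of "C \<union> K"] measure_nonneg[of \<mu> C] by linarith
  qed
  moreover have "prob (A \<union> B) = prob A + prob B" if "clopen A" "clopen B" "A \<inter> B = {}" for A B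
    using that by (intro finite_measure_Union) auto
  moreover have "prob (shift -` C) = prob C" if "clopen C" for C
    using inv_measures_vimage[OF \<mu> borel_measurable_shift, of C] that by (simp add: measure_def)
  moreover have "prob UNIV = 1" using prob_space by simp
  ultimately show ?thesis
    by (simp add: inv_contents_def contents_def clopen_content_def)
qed

text \<open>The extension comes from \<open>measure_from_clopen_content\<close>. Its invariance
  needs checking on cylinders only, and the complement of K is null as a countable union of null
  cylinders.\<close>

lemma inv_content_extends:
  fixes K :: "(int \<Rightarrow> 'a::{finite,discrete_topology}) set"
  assumes q: "q \<in> inv_contents K" and K: "closed K"
  obtains \<mu> where "\<mu> \<in> inv_measures shift K" "clopen_content \<mu> = q"
proof -
  have q': "\<And>C. 0 \<le> q C" "q UNIV = 1" "\<And>C. clopen C \<Longrightarrow> C \<inter> K = {} \<Longrightarrow> q C = 0"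
    "\<And>A B. clopen A \<Longrightarrow> clopen B \<Longrightarrow> A \<inter> B = {} \<Longrightarrow> q (A \<union> B) = q A + q B"
    "\<And>C. clopen C \<Longrightarrow> q (shift -` C) = q C" "\<And>C. \<not> clopen C \<Longrightarrow> q C = 0"
    using q by (simp_all add: inv_contents_def contents_def)
  obtain \<mu> where \<mu>: "sets \<mu> = sets borel" "prob_space \<mu>" "\<And>C. clopen C \<Longrightarrow> measure \<mu> C = q C"
    using measure_from_clopen_content[of q, OF q'(1,2,4)] by blast
  interpret prob_space \<mu> by (rule \<mu>(2))
  have sp: "space \<mu> = UNIV" using sets_eq_imp_space_eq[OF \<mu>(1)] by simp
  have m: "shift \<in> \<mu> \<rightarrow>\<^sub>M borel" using measurable_cong_sets[OF \<mu>(1) refl] borel_measurable_shift by blast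
  have "distr \<mu> borel shift = \<mu>"
  proof (rule measure_eqI_cylinders)
    show "prob_space (distr \<mu> borel shift)" by (rule prob_space_distr[OF m])
    show "measure (distr \<mu> borel shift) C = measure \<mu> C" if "C \<in> cylinders" for C
      using clopen_cylinder[OF that] q'(5)[of C] m by (simp add: measure_distr sp \<mu>(3))
  qed (use \<mu> in auto)
  moreover have "emeasure \<mu> (- K) = 0"
  proof -
    have "- K = \<Union>{C \<in> cylinders. C \<subseteq> - K}" using open_eq_Union_cylinders K by (metis open_Compl)
    moreover have "(\<Union>C\<in>{C \<in> cylinders. C \<subseteq> - K}. C) \<in> null_sets \<mu>"
    proof (rule null_sets_UN')
      show "countable {C \<in> cylinders. C \<subseteq> - K}"
        by (rule countable_subset[OF _ countable_cylinders]) auto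
      fix C assume C: "C \<in> {C \<in> cylinders. C \<subseteq> - K}"
      then have "clopen C" using clopen_cylinder by blast
      then show "C \<in> null_sets \<mu>"
        using C q'(3)[of C] \<mu>(1,3) by (auto simp: null_sets_def emeasure_eq_measure)
    qed
    ultimately show ?thesis by (simp add: null_sets_def)
  qed
  then have "emeasure \<mu> K = 1"
    using K \<mu>(1) prob_compl[of K] sp by (simp add: emeasure_eq_measure Compl_eq_Diff_UNIV)
  ultimately have "\<mu> \<in> inv_measures shift K" using \<mu> by (simp add: inv_measures_def)
  moreover have "clopen_content \<mu> = q"
    using \<mu>(3) q'(6) by (auto simp: clopen_content_def fun_eq_iff)
  ultimately show ?thesis using that by blast
qed

text \<open>Parametrises the invariant measures by a compact space, on which continuous functions
  attain their maxima.\<close>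

lemma clopen_content_image:
  fixes K :: "(int \<Rightarrow> 'a::{finite,discrete_topology}) set"
  assumes "closed K"
  shows "clopen_content ` inv_measures shift K = inv_contents K"
  using clopen_content_in_inv_contents[OF _ assms] inv_content_extends[OF _ assms] by blast

text \<open>Krylov--Bogolyubov: empirical contents along an orbit of length n are invariant up to 2/n.\<close>
lemma inv_contents_nonempty:
  fixes K :: "(int \<Rightarrow> 'a::topological_space) set"
  assumes K: "K \<noteq> {}" "shift ` K = K"
  shows "inv_contents K \<noteq> {}"
proof -
  obtain y where y: "y \<in> K" using K by auto
  \<comment> \<open>Tolerances that decrease with n give nested closed sets, and a common point of
    all of them is exactly invariant.\<close>
  define F where "F n = contents K \<inter> {q. \<forall>C. clopen C \<longrightarrow> \<bar>q (shift -` C) - q C\<bar> \<le> 2 / real (Suc n)}" for n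
  have "(\<Inter>n. F n) \<noteq> {}"
  proof (rule compact_nest_closed)
    have "closed {q :: (int \<Rightarrow> 'a) set \<Rightarrow> real. \<forall>C. clopen C \<longrightarrow> \<bar>q (shift -` C) - q C\<bar> \<le> 2 / real (Suc n)}" for n
      by (intro closed_Collect_all closed_Collect_imp open_Collect_const closed_Collect_le
          continuous_intros continuous_on_product_coordinates)
    then show "closed (F n)" for n
      unfolding F_def by (intro closed_Int closed_contents)
    then have "compact (contents K \<inter> F 0)" by (intro compact_Int_closed compact_contents)
    then show "compact (F 0)" by (simp add: F_def)
    show "F (Suc n) \<subseteq> F n" for n
    proof -
      have "2 / real (Suc (Suc n)) \<le> 2 / real (Suc n)" by (intro divide_left_mono) auto
      then show ?thesis unfolding F_def by (auto intro: order_trans)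
    qed
    show "F n \<noteq> {}" for n
    proof -
      define e where "e C = (\<Sum>i<Suc n. indicator C ((shift ^^ i) y)) / real (Suc n)" for C
      define q where "q C = (if clopen C then e C else 0)" for C
      have e01: "0 \<le> e C" "e C \<le> 1" for C
      proof -
        show "0 \<le> e C" by (simp add: e_def sum_nonneg)
        have "(\<Sum>i<Suc n. indicator C ((shift ^^ i) y)) \<le> (\<Sum>i<Suc n. 1 :: real)"
          by (intro sum_mono) (simp add: indicator_def)
        then show "e C \<le> 1" unfolding e_def by (simp add: divide_le_eq)
      qed
      have "e UNIV = 1" by (simp add: e_def)
      moreover have "e (A \<union> B) = e A + e B" if "A \<inter> B = {}" for A B
        using that by (simp add: e_def indicator_add[OF that, symmetric] sum.distrib add_divide_distrib)
      moreover have "e C = 0" if "C \<inter> K = {}" for C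
      proof -
        have "(shift ^^ i) y \<notin> C" for i using shift_funpow_mem[OF K(2) y] that by blast
        then show ?thesis by (simp add: e_def)
      qed
      ultimately have "q \<in> contents K"
        using e01 by (auto simp: contents_def q_def)
      moreover have "\<bar>e (shift -` C) - e C\<bar> \<le> 2 / real (Suc n)" for C
      proof -
        let ?I = "\<lambda>i. indicator C ((shift ^^ i) y) :: real"
        have "(\<Sum>i<Suc n. indicator (shift -` C) ((shift ^^ i) y)) = (\<Sum>i<Suc n. ?I (Suc i))"
          by (intro sum.cong) (auto simp: indicator_def)
        \<comment> \<open>Shifting the orbit segment by one step changes only its two end
          terms.\<close>
        then have "(\<Sum>i<Suc n. indicator (shift -` C) ((shift ^^ i) y)) - (\<Sum>i<Suc n. ?I i) = ?I (Suc n) - ?I 0"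
          using sum_lessThan_telescope[of ?I "Suc n"] by (simp only: sum_subtractf[symmetric])
        then have "e (shift -` C) - e C = (?I (Suc n) - ?I 0) / real (Suc n)"
          unfolding e_def by (simp only: diff_divide_distrib[symmetric])
        also have "\<bar>\<dots>\<bar> = \<bar>?I (Suc n) - ?I 0\<bar> / real (Suc n)" by (simp only: abs_divide abs_of_nat)
        also have "\<dots> \<le> 2 / real (Suc n)"
          by (intro divide_right_mono) (auto simp: indicator_def)
        finally show ?thesis .
      qed
      ultimately have "q \<in> F n" by (auto simp: F_def q_def)
      then show ?thesis by blast
    qed
  qed
  then obtain q where q: "\<And>n. q \<in> F n" by auto
  have "q (shift -` C) = q C" if "clopen C" for C
  proof -
    have "\<bar>q (shift -` C) - q C\<bar> \<le> 2 / real (Suc n)" for n using q[of n] that by (simp add: F_def)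
    moreover have "(\<lambda>n. 2 / real (Suc n)) \<longlonglongrightarrow> 0"
      using tendsto_mult_right_zero[OF LIMSEQ_inverse_real_of_nat, of 2] by (simp add: divide_inverse)
    ultimately have "\<bar>q (shift -` C) - q C\<bar> \<le> 0"
      by (intro LIMSEQ_le_const) auto
    then show ?thesis by simp
  qed
  then have "q \<in> inv_contents K" using q[of 0] by (auto simp: inv_contents_def F_def)
  then show ?thesis by blast
qed

subsection \<open>Block codes into a transitive shift of finite type\<close>

text \<open>Uniform continuity with cylinders in place of a metric: a finite subcover by products of
  cylinders on which f is within e/2 of its value at the centre yields one radius L.\<close>

lemma uniform_on_cylinders:
  fixes f :: "(int \<Rightarrow> 'a::discrete_topology) \<times> (int \<Rightarrow> 'b::discrete_topology) \<Rightarrow> real"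
  assumes X: "compact X" and Y: "compact Y" and f: "continuous_on (X \<times> Y) f" and e: "0 < e"
  obtains L where "\<And>x x' y y'. x \<in> X \<Longrightarrow> x' \<in> X \<Longrightarrow> y \<in> Y \<Longrightarrow> y' \<in> Y \<Longrightarrow>
    x' \<in> cyl L x \<Longrightarrow> y' \<in> cyl L y \<Longrightarrow> \<bar>f (x, y) - f (x', y')\<bar> \<le> e"
proof -
  have "\<exists>N. \<forall>w \<in> (cyl N (fst z) \<times> cyl N (snd z)) \<inter> (X \<times> Y). \<bar>f w - f z\<bar> < e / 2" if z: "z \<in> X \<times> Y" for z
  proof -
    obtain A where A: "open A" "A \<inter> (X \<times> Y) = f -` ball (f z) (e / 2) \<inter> (X \<times> Y)"
      using f[unfolded continuous_on_open_invariant, rule_format, OF open_ball[of "f z" "e / 2"]] by blast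
    have "z \<in> f -` ball (f z) (e / 2) \<inter> (X \<times> Y)" using z e by simp
    then have "z \<in> A" using A(2) by blast
    then obtain U V where UV: "open U" "open V" "z \<in> U \<times> V" "U \<times> V \<subseteq> A"
      using open_prod_elim[OF A(1)] by blast
    then have "fst z \<in> U" "snd z \<in> V" by auto
    then obtain N1 N2 where N1: "cyl N1 (fst z) \<subseteq> U" and N2: "cyl N2 (snd z) \<subseteq> V"
      using open_contains_cyl UV(1,2) by metis
    have "cyl (max N1 N2) (fst z) \<times> cyl (max N1 N2) (snd z) \<subseteq> A"
      using N1 N2 UV(4) cyl_antimono[of N1 "max N1 N2" "fst z"] cyl_antimono[of N2 "max N1 N2" "snd z"] by fastforce
    then have "\<forall>w \<in> (cyl (max N1 N2) (fst z) \<times> cyl (max N1 N2) (snd z)) \<inter> (X \<times> Y). f w \<in> ball (f z) (e / 2)"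
      using A(2) by blast
    then show ?thesis by (intro exI[of _ "max N1 N2"]) (auto simp: dist_real_def abs_minus_commute)
  qed
  then obtain N where N: "\<And>z w. z \<in> X \<times> Y \<Longrightarrow> w \<in> (cyl (N z) (fst z) \<times> cyl (N z) (snd z)) \<inter> (X \<times> Y) \<Longrightarrow>
      \<bar>f w - f z\<bar> < e / 2"
    by metis
  let ?W = "\<lambda>z. cyl (N z) (fst z) \<times> cyl (N z) (snd z)"
  obtain Z where Z: "Z \<subseteq> X \<times> Y" "finite Z" "X \<times> Y \<subseteq> (\<Union>z\<in>Z. ?W z)"
  proof (rule compactE_image[OF compact_Times[OF X Y], of "X \<times> Y" ?W])
    show "open (?W z)" for z by (intro open_Times open_cyl)
    show "X \<times> Y \<subseteq> (\<Union>z\<in>X \<times> Y. ?W z)"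
    proof
      fix z assume "z \<in> X \<times> Y"
      then show "z \<in> (\<Union>z\<in>X \<times> Y. ?W z)"
        by (intro UN_I[of z]) (simp_all add: mem_Times_iff)
    qed
  qed auto
  define L where "L = Max (insert 0 (N ` Z))"
  have L: "N z \<le> L" if "z \<in> Z" for z using that Z(2) by (simp add: L_def)
  show ?thesis
  proof (rule that[of L])
    fix x x' y y'
    assume x: "x \<in> X" "x' \<in> X" "y \<in> Y" "y' \<in> Y" "x' \<in> cyl L x" "y' \<in> cyl L y"
    then obtain z where z: "z \<in> Z" "(x, y) \<in> ?W z" using Z(3) by blast
    \<comment> \<open>The cover need not be shrunk: as for balls in an ultrametric space, a cylinder
      containing x contains every smaller cylinder around x.\<close>
    then have "x' \<in> cyl (N z) (fst z)" "y' \<in> cyl (N z) (snd z)"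
      using cyl_subset[of x "N z" "fst z", OF _ L] cyl_subset[of y "N z" "snd z", OF _ L] x by auto
    then have "\<bar>f (x', y') - f z\<bar> < e / 2" "\<bar>f (x, y) - f z\<bar> < e / 2"
      using N[of z] z x Z(1) by auto
    then show "\<bar>f (x, y) - f (x', y')\<bar> \<le> e" by linarith
  qed
qed

lemma continuous_on_locally_constant:
  fixes h :: "(int \<Rightarrow> 'b::discrete_topology) \<Rightarrow> 'c::topological_space"
  assumes "\<And>y y'. y' \<in> cyl R y \<Longrightarrow> h y' = h y"
  shows "continuous_on UNIV h"
  unfolding continuous_on_open_vimage[OF open_UNIV]
proof (intro allI impI)
  fix A :: "'c set"
  have "h -` A \<inter> UNIV = (\<Union>y\<in>h -` A. cyl R y)" using assms self_in_cyl by auto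
  then show "open (h -` A \<inter> UNIV)" by (simp only:) (intro open_UN ballI open_cyl)
qed

text \<open>The sequence u prescribes one point per block of length n. Block k shows positions 0 to
  n - 1 of the point glued from \<open>u k\<close> and \<open>u (k + 1)\<close>, so the transition
  to the next block occupies the end of the current one.\<close>

definition code :: "nat \<Rightarrow> ('x \<Rightarrow> 'x \<Rightarrow> int \<Rightarrow> 'a) \<Rightarrow> (int \<Rightarrow> 'x) \<Rightarrow> int \<Rightarrow> 'a" where
  "code n E u = (\<lambda>j. E (u (j div int n)) (u (j div int n + 1)) (j mod int n))"

lemma code_shift: "0 < n \<Longrightarrow> code n E (\<lambda>k. u (k + 1)) = (\<lambda>j. code n E u (j + int n))"
  by (simp add: code_def fun_eq_iff add.commute add.left_commute)

text \<open>The points glued for two consecutive blocks agree, at the start of the later block, on at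
  least M positions; so every window of length M + 1 already occurs in one glued point.\<close>
lemma code_in_sft:
  fixes E :: "(int \<Rightarrow> 'a) \<Rightarrow> (int \<Rightarrow> 'a) \<Rightarrow> int \<Rightarrow> 'a"
  assumes X: "X = {x. \<forall>j::int. map (\<lambda>i. x (j + int i)) [0..<M+1] \<notin> F}"
    and E: "\<And>x1 x2. x1 \<in> X \<Longrightarrow> x2 \<in> X \<Longrightarrow> E x1 x2 \<in> X \<and> (\<forall>j\<le>int n - int D - 1. E x1 x2 j = x1 j) \<and>
      (\<forall>j\<ge>int n. E x1 x2 j = x2 (j - int n))"
    and n: "M + D + 1 \<le> n" and u: "\<And>k. u k \<in> X"
  shows "code n E u \<in> X"
proof -
  have "map (\<lambda>i. code n E u (s + int i)) [0..<M+1] \<notin> F" for s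
  proof -
    define k r where "k = s div int n" and "r = s mod int n"
    have s: "s = k * int n + r" and r: "0 \<le> r" "r < int n" using n by (auto simp: k_def r_def)
    define z where "z = E (u k) (u (k + 1))"
    have z: "z \<in> X" using E u by (simp add: z_def)
    have "code n E u (s + int i) = z (r + int i)" if "i < M + 1" for i
    proof (cases "r + int i < int n")
      case True
      have "(s + int i) div int n = k" "(s + int i) mod int n = r + int i"
        using True r by (simp_all add: s add.assoc)
      then show ?thesis by (simp add: code_def z_def)
    next
      case False
      \<comment> \<open>The window runs into the next block, but by at most M positions, since r is
        at most n - 1 and i at most M. There \<open>n \<ge> M + D + 1\<close> guarantees that the
        next glued point still copies \<open>u (k + 1)\<close>, as does z beyond position n.\<close>
      have e: "s + int i = (k + 1) * int n + (r + int i - int n)" by (simp add: s algebra_simps)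
      have b: "0 \<le> r + int i - int n" "r + int i - int n < int n" using False r that n by auto
      have "(s + int i) div int n = k + 1" "(s + int i) mod int n = r + int i - int n"
        using int_div_pos_eq[OF _ b, of "s + int i" "k + 1"] int_mod_pos_eq[OF _ b, of "s + int i" "k + 1"] e
        by (simp_all only: mult.commute)
      then have "code n E u (s + int i) = E (u (k + 1)) (u (k + 2)) (r + int i - int n)"
        by (simp add: code_def add.assoc)
      also have "\<dots> = u (k + 1) (r + int i - int n)"
        using E[OF u u] r that n by auto
      also have "\<dots> = z (r + int i)"
        using E[OF u u] False by (auto simp: z_def)
      finally show ?thesis .
    qed
    then have eq: "map (\<lambda>i. code n E u (s + int i)) [0..<M+1] = map (\<lambda>i. z (r + int i)) [0..<M+1]"
      by (intro map_cong) auto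
    have "map (\<lambda>i. z (r + int i)) [0..<M+1] \<notin> F" using z by (subst (asm) X) blast
    then show ?thesis by (simp only: eq not_False_eq_True)
  qed
  then show ?thesis using X by blast
qed

text \<open>D is fixed before n: this is what keeps the cost of gluing independent of the block
  length. The second point is first translated so that its position 0 falls on n.\<close>

lemma transitive_glue:
  assumes X: "is_transitive X"
  obtains D where "\<And>n. \<exists>E. \<forall>x1\<in>X. \<forall>x2\<in>X. E x1 x2 \<in> X \<and> (\<forall>j\<le>int n - int D - 1. E x1 x2 j = x1 j) \<and>
      (\<forall>j\<ge>int n. E x1 x2 j = x2 (j - int n))"
proof -
  have inv: "shift ` X = X" using X by (simp add: is_transitive_def is_shift_def)
  obtain D where D: "\<And>x1 x2 b1 a2. x1 \<in> X \<Longrightarrow> x2 \<in> X \<Longrightarrow> a2 - b1 \<ge> int D \<Longrightarrow>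
      \<exists>x'\<in>X. (\<forall>j\<le>b1. x' j = x1 j) \<and> (\<forall>j\<ge>a2. x' j = x2 j)"
    using X unfolding is_transitive_def by blast
  show ?thesis
  proof (rule that[of D])
    fix n
    have "\<forall>x1\<in>X. \<forall>x2\<in>X. \<exists>x'. x' \<in> X \<and> (\<forall>j\<le>int n - int D - 1. x' j = x1 j) \<and>
      (\<forall>j\<ge>int n. x' j = x2 (j - int n))"
    proof (intro ballI)
      fix x1 x2 assume x: "x1 \<in> X" "x2 \<in> X"
      then have "(\<lambda>j. x2 (j + - int n)) \<in> X" by (intro shift_int_mem[OF inv])
      then show "\<exists>x'. x' \<in> X \<and> (\<forall>j\<le>int n - int D - 1. x' j = x1 j) \<and> (\<forall>j\<ge>int n. x' j = x2 (j - int n))"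
        using D[of x1 "\<lambda>j. x2 (j + - int n)" "int n" "int n - int D - 1"] x by auto
    qed
    then show "\<exists>E. \<forall>x1\<in>X. \<forall>x2\<in>X. E x1 x2 \<in> X \<and> (\<forall>j\<le>int n - int D - 1. E x1 x2 j = x1 j) \<and>
      (\<forall>j\<ge>int n. E x1 x2 j = x2 (j - int n))"
      by metis
  qed
qed

text \<open>The block of \<open>G y\<close> at kn is built from the windows of y around kn and
  (k+1)n. Finite dependence makes G continuous, and moving y by n merely renumbers the blocks. Only
  the first n - D positions of a block are guaranteed to follow the prescription p.\<close>

lemma block_code:
  fixes X :: "(int \<Rightarrow> 'a::{finite,discrete_topology}) set"
  assumes sft: "is_sft X" and tr: "is_transitive X"
  obtains n0 D where
    "\<And>n N (p :: (int \<Rightarrow> 'b::discrete_topology) set \<Rightarrow> int \<Rightarrow> 'a). n0 \<le> n \<Longrightarrow> range p \<subseteq> X \<Longrightarrow>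
       \<exists>G. continuous_on UNIV G \<and> (\<forall>y. G y \<in> X) \<and> (\<forall>y. G ((shift ^^ n) y) = (shift ^^ n) (G y)) \<and>
         (\<forall>y j. 0 \<le> j \<longrightarrow> j < int n - int D \<longrightarrow> G y j = p (cyl N y) j)"
proof -
  obtain M F where X: "X = {x. \<forall>j::int. map (\<lambda>i. x (j + int i)) [0..<M+1] \<notin> F}"
    using sft unfolding is_sft_def by blast
  obtain D where D: "\<And>n. \<exists>E. \<forall>x1\<in>X. \<forall>x2\<in>X. E x1 x2 \<in> X \<and> (\<forall>j\<le>int n - int D - 1. E x1 x2 j = x1 j) \<and>
      (\<forall>j\<ge>int n. E x1 x2 j = x2 (j - int n))"
    using transitive_glue[OF tr] by blast
  show ?thesis
  proof (rule that[of "M + D + 1" D])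
    fix n N and p :: "(int \<Rightarrow> 'b) set \<Rightarrow> int \<Rightarrow> 'a"
    assume n: "M + D + 1 \<le> n" and p: "range p \<subseteq> X"
    obtain E where E: "\<And>x1 x2. x1 \<in> X \<Longrightarrow> x2 \<in> X \<Longrightarrow> E x1 x2 \<in> X \<and> (\<forall>j\<le>int n - int D - 1. E x1 x2 j = x1 j) \<and>
      (\<forall>j\<ge>int n. E x1 x2 j = x2 (j - int n))"
      using D[of n] by blast
    define u where "u y k = p (cyl N (\<lambda>j. y (j + k * int n)))" for y k
    have u: "u y k \<in> X" for y k using p by (auto simp: u_def)
    define G where "G y = code n E (u y)" for y
    have "continuous_on UNIV G"
    proof (rule continuous_on_coordinatewise_then_product)
      fix j
      \<comment> \<open>Coordinate j of \<open>G y\<close> uses the prescriptions for the blocks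
        \<open>j div n\<close> and \<open>j div n + 1\<close>. R covers a window of radius N around
        the start of each.\<close>
      define R where "R = N + nat ((\<bar>j div int n\<bar> + 1) * int n)"
      have u_eq: "u y' k = u y k" if "y' \<in> cyl R y" "\<bar>k\<bar> \<le> \<bar>j div int n\<bar> + 1" for y y' k
      proof -
        have "\<bar>k * int n\<bar> \<le> (\<bar>j div int n\<bar> + 1) * int n"
          using that(2) by (simp add: abs_mult mult_right_mono)
        then have "y' (i + k * int n) = y (i + k * int n)" if "\<bar>i\<bar> \<le> int N" for i
          using that \<open>y' \<in> cyl R y\<close> by (simp add: cyl_def R_def)
        then have "(\<lambda>i. y' (i + k * int n)) \<in> cyl N (\<lambda>i. y (i + k * int n))"
          by (simp add: cyl_def)
        then show ?thesis unfolding u_def by (simp add: cyl_cong)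
      qed
      have "G y' j = G y j" if "y' \<in> cyl R y" for y y'
        using u_eq[OF that, of "j div int n"] u_eq[OF that, of "j div int n + 1"]
        by (simp add: G_def code_def)
      then show "continuous_on UNIV (\<lambda>y. G y j)"
        by (rule continuous_on_locally_constant)
    qed
    moreover have "G y \<in> X" for y
      unfolding G_def by (rule code_in_sft[OF X E n u])
    moreover have "G ((shift ^^ n) y) = (shift ^^ n) (G y)" for y
    proof -
      have "u ((shift ^^ n) y) = (\<lambda>k. u y (k + 1))"
        by (simp add: u_def shift_funpow algebra_simps fun_eq_iff)
      then show ?thesis using code_shift[of n E "u y"] n by (simp add: G_def shift_funpow)
    qed
    moreover have "G y j = p (cyl N y) j" if "0 \<le> j" "j < int n - int D" for y j
    proof -
      have "G y j = E (u y 0) (u y 1) j" using that by (simp add: G_def code_def)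
      also have "\<dots> = u y 0 j" using E[OF u u] that by auto
      finally show ?thesis by (simp add: u_def)
    qed
    ultimately show "\<exists>G. continuous_on UNIV G \<and> (\<forall>y. G y \<in> X) \<and> (\<forall>y. G ((shift ^^ n) y) = (shift ^^ n) (G y)) \<and>
         (\<forall>y j. 0 \<le> j \<longrightarrow> j < int n - int D \<longrightarrow> G y j = p (cyl N y) j)"
      by blast
  qed
qed

section \<open>Averaging a measure invariant under the n-th power\<close>

lemma measurable_funpow:
  assumes "T \<in> M \<rightarrow>\<^sub>M M"
  shows "T ^^ i \<in> M \<rightarrow>\<^sub>M M"
proof (induction i)
  case (Suc i)
  then show ?case using measurable_comp[OF Suc assms] by (simp only: funpow.simps)
qed (simp add: id_def)

text \<open>The average is realised by binding the uniform distribution on the indices below n with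
  the images of m, which supplies the formulas for measures and for integrals together. Applying T
  moves the sum by one index, and the two end terms agree because \<open>T ^^ n\<close> preserves
  m.\<close>

lemma average_measure:
  fixes m :: "'z::topological_space measure"
  assumes m [measurable_cong]: "sets m = sets borel" and "prob_space m"
    and T [measurable]: "T \<in> borel \<rightarrow>\<^sub>M borel" and n: "0 < n" and inv: "distr m borel (T ^^ n) = m"
  obtains \<Lambda> where "sets \<Lambda> = sets borel" "prob_space \<Lambda>" "distr \<Lambda> borel T = \<Lambda>"
    "\<And>A. A \<in> sets borel \<Longrightarrow> measure \<Lambda> A = (\<Sum>i<n. measure m ((T ^^ i) -` A)) / n"
    "\<And>F :: 'z \<Rightarrow> real. \<And>B. F \<in> borel_measurable borel \<Longrightarrow> (\<And>z. \<bar>F z\<bar> \<le> B) \<Longrightarrow>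
       (\<integral>z. F z \<partial>\<Lambda>) = (\<Sum>i<n. \<integral>z. F ((T ^^ i) z) \<partial>m) / n"
proof -
  interpret m: prob_space m by fact
  have sp: "space m = UNIV" using sets_eq_imp_space_eq[OF m] by simp
  have Ti [measurable]: "T ^^ i \<in> borel \<rightarrow>\<^sub>M borel" for i by (rule measurable_funpow[OF T])
  let ?U = "measure_pmf (pmf_of_set {..<n})"
  let ?K = "\<lambda>i. distr m borel (T ^^ i)"
  define \<Lambda> where "\<Lambda> = ?U \<bind> ?K"
  have fin: "finite {..<n}" "{..<n} \<noteq> {}" using n by auto
  have Kp: "prob_space (?K i)" for i by (rule m.prob_space_distr) measurable
  have Ke: "emeasure (?K i) UNIV = 1" for i
    using prob_space.emeasure_space_1[OF Kp] by simp
  have K: "?K \<in> measurable ?U (subprob_algebra borel)"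
    using Kp prob_space_imp_subprob_space by (auto simp: space_subprob_algebra)
  have sets: "sets \<Lambda> = sets borel" unfolding \<Lambda>_def by (rule sets_bind) auto
  have spl: "space \<Lambda> = UNIV" using sets_eq_imp_space_eq[OF sets] by simp
  have prob: "prob_space \<Lambda>"
    unfolding \<Lambda>_def by (rule measure_pmf.prob_space_bind[OF _ K]) (simp add: Kp)
  have meas: "measure \<Lambda> A = (\<Sum>i<n. measure m ((T ^^ i) -` A)) / n" if "A \<in> sets borel" for A
  proof -
    have "measure \<Lambda> A = (\<integral>i. measure (?K i) A \<partial>?U)"
      unfolding \<Lambda>_def by (rule subprob_space.measure_bind[OF _ K that]) (rule measure_pmf.subprob_space_axioms)
    also have "\<dots> = (\<Sum>i<n. measure (?K i) A) / n"
      using fin by (simp add: integral_pmf_of_set)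
    finally show ?thesis using that by (simp add: measure_distr sp)
  qed
  have int: "(\<integral>z. F z \<partial>\<Lambda>) = (\<Sum>i<n. \<integral>z. F ((T ^^ i) z) \<partial>m) / n"
    if F: "F \<in> borel_measurable borel" "\<And>z. \<bar>F z\<bar> \<le> B" for F :: "'z \<Rightarrow> real" and B
  proof -
    have "(\<integral>z. F z \<partial>\<Lambda>) = (\<integral>i. (\<integral>z. F z \<partial>?K i) \<partial>?U)"
      unfolding \<Lambda>_def
      by (rule integral_bind[where B = B and B' = 1, OF F(1) _ K])
        (use F Ke in \<open>auto intro: measure_pmf.finite_measure_axioms\<close>)
    also have "\<dots> = (\<Sum>i<n. \<integral>z. F z \<partial>?K i) / n"
      using fin by (simp add: integral_pmf_of_set)
    finally show ?thesis using F by (simp add: integral_distr)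
  qed
  have "distr \<Lambda> borel T = \<Lambda>"
  proof (rule measure_eqI)
    fix A assume "A \<in> sets (distr \<Lambda> borel T)"
    then have A [measurable]: "A \<in> sets borel" by simp
    have TA: "T -` A \<in> sets borel" using measurable_sets[OF T A] by simp
    have T': "T \<in> \<Lambda> \<rightarrow>\<^sub>M borel" using measurable_cong_sets[OF sets refl] T by blast
    interpret l: prob_space \<Lambda> by (rule prob)
    interpret d: prob_space "distr \<Lambda> borel T" by (rule l.prob_space_distr[OF T'])
    let ?a = "\<lambda>i. measure m ((T ^^ i) -` A)"
    have "?a n = measure (distr m borel (T ^^ n)) A" by (simp add: measure_distr sp)
    then have an: "?a n = ?a 0" by (simp add: inv)
    have "(T ^^ i) -` T -` A = (T ^^ Suc i) -` A" for i by auto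
    then have "measure \<Lambda> (T -` A) = (\<Sum>i<n. ?a (Suc i)) / n" using meas[OF TA] by simp
    also have "(\<Sum>i<n. ?a (Suc i)) = (\<Sum>i<n. ?a i)"
      using sum_lessThan_telescope[of ?a n] an by (simp add: sum_subtractf)
    finally have "measure \<Lambda> (T -` A) = measure \<Lambda> A" using meas[OF A] by simp
    then show "emeasure (distr \<Lambda> borel T) A = emeasure \<Lambda> A"
      using T' by (simp add: d.emeasure_eq_measure l.emeasure_eq_measure measure_distr spl)
  qed (simp add: sets)
  then show ?thesis using that sets prob meas int by blast
qed

subsection \<open>Approximation of psi by locally constant integrals\<close>

abbreviation shift2 :: "(int \<Rightarrow> 'a) \<times> (int \<Rightarrow> 'b) \<Rightarrow> (int \<Rightarrow> 'a) \<times> (int \<Rightarrow> 'b)" where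
  "shift2 \<equiv> \<lambda>(x, y). (shift x, shift y)"

lemma shift2_funpow: "(shift2 ^^ i) (x, y) = ((shift ^^ i) x, (shift ^^ i) y)"
  by (induction i) auto

lemma borel_measurable_shift2 [measurable]:
  "shift2 \<in> borel \<rightarrow>\<^sub>M (borel :: ((int \<Rightarrow> 'a::topological_space) \<times> (int \<Rightarrow> 'b::topological_space)) measure)"
  unfolding case_prod_beta
  by (intro borel_measurable_continuous_onI continuous_on_Pair
      continuous_on_compose2[OF continuous_on_shift] continuous_intros) auto

lemma borel_measurable_snd [measurable]:
  "snd \<in> borel_measurable (borel :: ('a::topological_space \<times> 'b::topological_space) measure)"
  by (intro borel_measurable_continuous_onI continuous_intros)

lemma funpow_in_cyl:
  assumes "x' \<in> cyl (n + L) x" "i \<le> n"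
  shows "(shift ^^ i) x' \<in> cyl L ((shift ^^ i) x)"
  using assms by (auto simp: cyl_def shift_funpow)

text \<open>c is the Birkhoff average along a block that is almost optimal for one representative of
  each cylinder. In the lower bound one e pays for passing from y to the representative and one for
  near-minimality. In the upper bound one e pays for passing to the prescribed block and the
  representative, one for the indices near the ends of the block, and the third is slack.\<close>

lemma block_selection:
  fixes X :: "(int \<Rightarrow> 'a::{finite,discrete_topology}) set"
    and Y :: "(int \<Rightarrow> 'b::{finite,discrete_topology}) set"
    and f :: "(int \<Rightarrow> 'a) \<times> (int \<Rightarrow> 'b) \<Rightarrow> real"
  assumes X: "is_shift X" and Y: "is_shift Y" and sft: "is_sft X" and tr: "is_transitive X"
    and f: "continuous_on (X \<times> Y) f" and B: "\<And>z. z \<in> X \<times> Y \<Longrightarrow> \<bar>f z\<bar> \<le> B" and e: "0 < e"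
  obtains n N :: nat and c :: "(int \<Rightarrow> 'b) set \<Rightarrow> real" and G :: "(int \<Rightarrow> 'b) \<Rightarrow> (int \<Rightarrow> 'a)"
  where "0 < n" "continuous_on UNIV G" "\<And>y. G y \<in> X" "\<And>y. G ((shift ^^ n) y) = (shift ^^ n) (G y)"
    "\<And>x y. x \<in> X \<Longrightarrow> y \<in> Y \<Longrightarrow> real n * (c (cyl N y) - 2 * e) \<le> (\<Sum>i<n. f ((shift2 ^^ i) (x, y)))"
    "\<And>y. y \<in> Y \<Longrightarrow> (\<Sum>i<n. f ((shift2 ^^ i) (G y, y))) \<le> real n * (c (cyl N y) + 3 * e)"
proof -
  have cX: "compact X" "X \<noteq> {}" "shift ` X = X" and cY: "compact Y" "shift ` Y = Y"
    using X Y by (auto simp: is_shift_def)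
  note mX = shift_funpow_mem[OF cX(3)] and mY = shift_funpow_mem[OF cY(2)]
  obtain L where L: "\<And>x x' y y'. x \<in> X \<Longrightarrow> x' \<in> X \<Longrightarrow> y \<in> Y \<Longrightarrow> y' \<in> Y \<Longrightarrow>
    x' \<in> cyl L x \<Longrightarrow> y' \<in> cyl L y \<Longrightarrow> \<bar>f (x, y) - f (x', y')\<bar> \<le> e"
    using uniform_on_cylinders[OF cX(1) cY(1) f e] by blast
  obtain n0 D where code: "\<And>n N (p :: (int \<Rightarrow> 'b) set \<Rightarrow> int \<Rightarrow> 'a). n0 \<le> n \<Longrightarrow> range p \<subseteq> X \<Longrightarrow>
       \<exists>G. continuous_on UNIV G \<and> (\<forall>y. G y \<in> X) \<and> (\<forall>y. G ((shift ^^ n) y) = (shift ^^ n) (G y)) \<and>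
         (\<forall>y j. 0 \<le> j \<longrightarrow> j < int n - int D \<longrightarrow> G y j = p (cyl N y) j)"
    by (rule block_code[OF sft tr]) (rule that)
  \<comment> \<open>At most 2 L + D indices are bad and each costs at most 2 B; their total cost is
    to stay below n e.\<close>
  obtain n1 :: nat where n1: "2 * B * (2 * L + D) / e \<le> n1" using real_arch_simple by blast
  define n where "n = max (max n0 n1) 1"
  have n: "n0 \<le> n" "0 < n" by (auto simp: n_def)
  have "2 * B * (2 * L + D) / e \<le> real n" using n1 by (simp add: n_def)
  then have nB: "2 * B * (2 * L + D) \<le> n * e" using e by (simp add: divide_le_eq)
  \<comment> \<open>With this radius, two points of one cylinder agree on the L-window around each
    of the positions 0 to n.\<close>
  define N where "N = n + L"
  define S where "S x y = (\<Sum>i<n. f ((shift2 ^^ i) (x, y)))" for x y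
  define r where "r C = (SOME y. y \<in> C \<inter> Y)" for C
  \<comment> \<open>An e-optimal choice suffices, so no minimiser has to be produced. The guard
    \<open>r C \<in> Y\<close> covers cylinders that miss Y: \<open>p C\<close> then is still some
    point of X, as \<open>block_code\<close> demands.\<close>
  define p where "p C = (SOME x. x \<in> X \<and> (r C \<in> Y \<longrightarrow> (\<forall>x'\<in>X. S x (r C) \<le> S x' (r C) + n * e)))" for C
  define c where "c C = S (p C) (r C) / n" for C
  have S_lower: "- (n * B) \<le> S x y" if "x \<in> X" "y \<in> Y" for x y
  proof -
    have "- B \<le> f ((shift2 ^^ i) (x, y))" for i
      using B[of "(shift2 ^^ i) (x, y)"] that by (auto simp: shift2_funpow mX mY)
    from sum_mono[OF this, of "{..<n}"] show ?thesis by (simp add: S_def)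
  qed
  have p: "p C \<in> X \<and> (r C \<in> Y \<longrightarrow> (\<forall>x'\<in>X. S (p C) (r C) \<le> S x' (r C) + n * e))" for C
  proof -
    have "\<exists>x. x \<in> X \<and> (r C \<in> Y \<longrightarrow> (\<forall>x'\<in>X. S x (r C) \<le> S x' (r C) + n * e))"
    proof (cases "r C \<in> Y")
      case True
      let ?V = "(\<lambda>x. S x (r C)) ` X"
      have bdd: "bdd_below ?V" using S_lower True by (intro bdd_belowI[of _ "- (n * B)"]) auto
      have "\<exists>v\<in>?V. v < Inf ?V + n * e"
        by (rule cInf_lessD) (use cX(2) e n in auto)
      then obtain x where x: "x \<in> X" "S x (r C) < Inf ?V + n * e" by auto
      have "S x (r C) \<le> S x' (r C) + n * e" if "x' \<in> X" for x'
        using x(2) cInf_lower[OF imageI[OF that] bdd] by auto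
      then show ?thesis using x(1) by blast
    qed (use cX(2) in auto)
    then show ?thesis unfolding p_def by (rule someI_ex)
  qed
  have r: "r (cyl N y) \<in> cyl N y" "r (cyl N y) \<in> Y" if "y \<in> Y" for y
    using someI[of "\<lambda>z. z \<in> cyl N y \<inter> Y" y] that by (auto simp: r_def)
  have orb: "(shift ^^ i) (r (cyl N y)) \<in> cyl L ((shift ^^ i) y)" if "y \<in> Y" "i < n" for y i
    using funpow_in_cyl[OF r(1)[OF that(1), unfolded N_def], of i] that(2) by (simp add: N_def)
  have "range p \<subseteq> X" using p by auto
  from code[OF n(1) this, of N] obtain G
    where "continuous_on UNIV G \<and> (\<forall>y. G y \<in> X) \<and> (\<forall>y. G ((shift ^^ n) y) = (shift ^^ n) (G y)) \<and>
         (\<forall>y j. 0 \<le> j \<longrightarrow> j < int n - int D \<longrightarrow> G y j = p (cyl N y) j)"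
    by (rule exE)
  then have G: "continuous_on UNIV G" "\<And>y. G y \<in> X" "\<And>y. G ((shift ^^ n) y) = (shift ^^ n) (G y)"
    "\<And>y j. 0 \<le> j \<Longrightarrow> j < int n - int D \<Longrightarrow> G y j = p (cyl N y) j"
    by simp_all
  show ?thesis
  proof (rule that[of n G c N])
    fix x y assume xy: "x \<in> X" "y \<in> Y"
    let ?y = "r (cyl N y)"
    have "f ((shift2 ^^ i) (x, ?y)) - e \<le> f ((shift2 ^^ i) (x, y))" if "i < n" for i
      using L[OF mX[OF xy(1), of i] mX[OF xy(1), of i] mY[OF xy(2), of i] mY[OF r(2)[OF xy(2)], of i] self_in_cyl
        orb[OF xy(2) that]] by (simp add: shift2_funpow)
    then have "(\<Sum>i<n. f ((shift2 ^^ i) (x, ?y)) - e) \<le> S x y"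
      unfolding S_def by (intro sum_mono) simp
    then have "S x ?y - n * e \<le> S x y" by (simp add: S_def sum_subtractf)
    moreover have "S (p (cyl N y)) ?y \<le> S x ?y + n * e" using p r(2)[OF xy(2)] xy(1) by blast
    moreover have "n * c (cyl N y) = S (p (cyl N y)) ?y" using n(2) by (simp add: c_def)
    ultimately show "real n * (c (cyl N y) - 2 * e) \<le> (\<Sum>i<n. f ((shift2 ^^ i) (x, y)))"
      by (simp add: S_def[symmetric] algebra_simps)
  next
    fix y assume y: "y \<in> Y"
    let ?y = "r (cyl N y)" and ?p = "p (cyl N y)"
    have pX: "?p \<in> X" using p by blast
    \<comment> \<open>The indices whose L-window leaves the positions 0 to n - D - 1, on which
      \<open>G y\<close> is known to copy the prescribed point.\<close>
    define J where "J = {i. i < n \<and> (i < L \<or> n \<le> i + L + D)}"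
    have le: "f ((shift2 ^^ i) (G y, y)) \<le> f ((shift2 ^^ i) (?p, ?y)) + e + (if i \<in> J then 2 * B else 0)"
      if i: "i < n" for i
    proof (cases "i \<in> J")
      case True
      have "\<bar>f ((shift2 ^^ i) (G y, y))\<bar> \<le> B" "\<bar>f ((shift2 ^^ i) (?p, ?y))\<bar> \<le> B"
        using B mX mY G(2) pX y r(2)[OF y] by (auto simp: shift2_funpow)
      then show ?thesis using True e by auto
    next
      case False
      have "?p \<in> X" "(shift ^^ i) ?p \<in> cyl L ((shift ^^ i) (G y))"
        using pX False i G(4)[of _ y] by (auto simp: cyl_def shift_funpow J_def)
      from L[OF mX[OF G(2)] mX[OF this(1)] mY[OF y] mY[OF r(2)[OF y]] this(2) orb[OF y i]]
      show ?thesis using False by (simp add: shift2_funpow)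
    qed
    have "J \<subseteq> {..<L} \<union> {n - (L + D)..<n}" by (auto simp: J_def)
    then have "card J \<le> card ({..<L} \<union> {n - (L + D)..<n})" by (intro card_mono) auto
    also have "\<dots> \<le> card {..<L} + card {n - (L + D)..<n}" by (rule card_Un_le)
    also have "\<dots> \<le> 2 * L + D" by auto
    finally have J: "card J \<le> 2 * L + D" .
    have B0: "0 \<le> B" using B[of "(?p, ?y)"] pX r(2)[OF y] by auto
    have "(\<Sum>i<n. if i \<in> J then 2 * B else 0) = (\<Sum>i\<in>J. 2 * B)"
      by (intro sum.mono_neutral_cong_right) (auto simp: J_def)
    also have "\<dots> = card J * (2 * B)" by simp
    also have "\<dots> \<le> (2 * L + D) * (2 * B)" using J B0 by (intro mult_right_mono) auto
    also have "\<dots> \<le> n * e" using nB by (simp add: mult.commute mult.left_commute)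
    finally have J': "(\<Sum>i<n. if i \<in> J then 2 * B else 0) \<le> n * e" .
    have "S (G y) y \<le> (\<Sum>i<n. f ((shift2 ^^ i) (?p, ?y)) + e + (if i \<in> J then 2 * B else 0))"
      unfolding S_def by (intro sum_mono le) simp
    also have "\<dots> = S ?p ?y + n * e + (\<Sum>i<n. if i \<in> J then 2 * B else 0)"
      by (simp add: sum.distrib S_def)
    also have "\<dots> \<le> S ?p ?y + n * e + n * e" using J' by linarith
    also have "\<dots> \<le> n * (c (cyl N y) + 3 * e)" using n(2) e by (simp add: c_def algebra_simps)
    finally show "(\<Sum>i<n. f ((shift2 ^^ i) (G y, y))) \<le> real n * (c (cyl N y) + 3 * e)"
      by (simp add: S_def)
  qed (use n G in auto)
qed

lemma integral_funpow_invariant: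
  fixes F :: "'z::topological_space \<Rightarrow> real"
  assumes L: "L \<in> inv_measures T K" and T: "T \<in> borel \<rightarrow>\<^sub>M borel" and F: "F \<in> borel_measurable borel"
  shows "(\<integral>z. F ((T ^^ i) z) \<partial>L) = (\<integral>z. F z \<partial>L)"
proof (induction i)
  case (Suc i)
  have TL: "T \<in> L \<rightarrow>\<^sub>M borel" using T measurable_cong_sets[OF inv_measuresD(1)[OF L] refl] by blast
  have "T ^^ i \<in> borel \<rightarrow>\<^sub>M borel" by (rule measurable_funpow[OF T])
  then have "(\<lambda>z. F ((T ^^ i) z)) \<in> borel_measurable borel" using F by measurable
  from integral_distr[OF TL this] have "(\<integral>z. F ((T ^^ i) (T z)) \<partial>L) = (\<integral>z. F ((T ^^ i) z) \<partial>L)"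
    by (simp add: inv_measuresD(5)[OF L])
  then show ?case using Suc by (simp add: funpow_swap1)
qed simp

text \<open>Each y lies in exactly one cylinder of radius N, so the function is a finite combination
  of indicators.\<close>

lemma integral_cylinder_step:
  fixes \<nu> :: "(int \<Rightarrow> 'b::{finite,discrete_topology}) measure"
  assumes "prob_space \<nu>" and [measurable_cong]: "sets \<nu> = sets borel"
  shows "integrable \<nu> (\<lambda>y. c (cyl N y) :: real)"
    and "(\<integral>y. c (cyl N y) \<partial>\<nu>) = (\<Sum>C\<in>range (cyl N). c C * measure \<nu> C)"
proof -
  interpret prob_space \<nu> by fact
  have eq: "c (cyl N y) = (\<Sum>C\<in>range (cyl N). c C * indicator C y)" for y
  proof -
    have "(\<Sum>C\<in>range (cyl N). c C * indicator C y) = (\<Sum>C\<in>{cyl N y}. c C * indicator C y)"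
      by (intro sum.mono_neutral_right finite_range_cyl) (auto simp: indicator_def dest: cyl_cong)
    then show ?thesis by simp
  qed
  have i: "integrable \<nu> (\<lambda>y. c C * indicator C y)" if "C \<in> range (cyl N)" for C
    using that by (intro integrable_mult_right integrable_real_indicator) (auto simp: assms(2) open_cyl emeasure_eq_measure)
  show "integrable \<nu> (\<lambda>y. c (cyl N y))"
    unfolding eq by (intro Bochner_Integration.integrable_sum i)
  have "(\<integral>y. c (cyl N y) \<partial>\<nu>) = (\<Sum>C\<in>range (cyl N). \<integral>y. c C * indicator C y \<partial>\<nu>)"
    unfolding eq by (intro Bochner_Integration.integral_sum i)
  also have "\<dots> = (\<Sum>C\<in>range (cyl N). c C * measure \<nu> C)"
    by (intro sum.cong refl) (auto simp: sets_eq_imp_space_eq[OF assms(2)])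
  finally show "(\<integral>y. c (cyl N y) \<partial>\<nu>) = (\<Sum>C\<in>range (cyl N). c C * measure \<nu> C)" .
qed

text \<open>N and c are chosen before \<open>\<nu>\<close>. This uniformity carries continuity and
  affinity from finite sums of cylinder measures over to \<open>psi\<close>.\<close>

lemma psi_approximation:
  fixes X :: "(int \<Rightarrow> 'a::{finite,discrete_topology}) set"
    and Y :: "(int \<Rightarrow> 'b::{finite,discrete_topology}) set"
    and f :: "(int \<Rightarrow> 'a) \<times> (int \<Rightarrow> 'b) \<Rightarrow> real"
  assumes X: "is_shift X" and Y: "is_shift Y" and sft: "is_sft X" and tr: "is_transitive X"
    and f: "continuous_on (X \<times> Y) f" and e: "0 < e"
  obtains N c where "\<And>\<nu>. \<nu> \<in> inv_measures shift Y \<Longrightarrow>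
    \<bar>psi f X Y \<nu> - (\<Sum>C\<in>range (cyl N). c C * measure \<nu> C)\<bar> \<le> e"
proof -
  have cXY: "compact (X \<times> Y)" "closed (X \<times> Y)" and sX: "shift ` X = X" and sY: "shift ` Y = Y"
    using X Y by (auto simp: is_shift_def intro: compact_Times closed_Times closed_of_compact_fun)
  have XYb [measurable]: "X \<times> Y \<in> sets borel" using cXY by simp
  \<comment> \<open>Extending f by 0 gives a bounded Borel function on the whole space whose plain
    integral is the set integral occurring in \<open>psi\<close>.\<close>
  define F where "F z = indicator (X \<times> Y) z *\<^sub>R f z" for z
  have F [measurable]: "F \<in> borel_measurable borel"
    unfolding F_def by (rule borel_measurable_continuous_on_indicator[OF XYb f])
  obtain B where B: "\<And>z. z \<in> X \<times> Y \<Longrightarrow> \<bar>f z\<bar> \<le> B"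
    using compact_imp_bounded[OF compact_continuous_image[OF f cXY(1)]] unfolding bounded_iff by auto
  have FB: "\<bar>F z\<bar> \<le> \<bar>B\<bar>" for z using B[of z] by (auto simp: F_def indicator_def)
  \<comment> \<open>The upper bound of \<open>block_selection\<close> loses three times its
    tolerance.\<close>
  have e3: "0 < e / 3" using e by simp
  obtain n N c G where n: "0 < n" and G: "continuous_on UNIV G" "\<And>y. G y \<in> X"
      "\<And>y. G ((shift ^^ n) y) = (shift ^^ n) (G y)"
    and lo: "\<And>x y. x \<in> X \<Longrightarrow> y \<in> Y \<Longrightarrow> real n * (c (cyl N y) - 2 * (e/3)) \<le> (\<Sum>i<n. f ((shift2 ^^ i) (x, y)))"
    and up: "\<And>y. y \<in> Y \<Longrightarrow> (\<Sum>i<n. f ((shift2 ^^ i) (G y, y))) \<le> real n * (c (cyl N y) + 3 * (e/3))"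
    using block_selection[OF X Y sft tr f B e3, where thesis = thesis] by blast
  have orb: "(shift2 ^^ i) (x, y) \<in> X \<times> Y" if "x \<in> X" "y \<in> Y" for i x y
    using that shift_funpow_mem[OF sX] shift_funpow_mem[OF sY] by (simp add: shift2_funpow)
  have Ff: "F ((shift2 ^^ i) (x, y)) = f ((shift2 ^^ i) (x, y))" if "x \<in> X" "y \<in> Y" for i x y
    using orb[OF that, of i] by (simp add: F_def)
  have T [measurable]: "shift2 ^^ i \<in> borel \<rightarrow>\<^sub>M (borel :: ((int \<Rightarrow> 'a) \<times> (int \<Rightarrow> 'b)) measure)" for i
    by (rule measurable_funpow[OF borel_measurable_shift2])
  show ?thesis
  proof (rule that)
    fix \<nu> assume \<nu>: "\<nu> \<in> inv_measures shift Y"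
    interpret \<nu>: prob_space \<nu> by (rule inv_measuresD(3)[OF \<nu>])
    note [measurable_cong, simp] = inv_measuresD(1)[OF \<nu>]
    note [simp] = inv_measuresD(2)[OF \<nu>]
    define lifts where "lifts = {L. L \<in> inv_measures shift2 (X \<times> Y) \<and> distr L borel snd = \<nu>}"
    define s where "s = (\<Sum>C\<in>range (cyl N). c C * measure \<nu> C)"
    have step: "integrable \<nu> (\<lambda>y. c (cyl N y))" "(\<integral>y. c (cyl N y) \<partial>\<nu>) = s"
      unfolding s_def by (rule integral_cylinder_step; simp add: \<nu>.prob_space_axioms)+
    have stepm: "(\<lambda>y. c (cyl N y)) \<in> borel_measurable borel"
      using borel_measurable_integrable[OF step(1)] measurable_cong_sets[OF inv_measuresD(1)[OF \<nu>] refl] by blast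
    have psi: "psi f X Y \<nu> = Inf ((\<lambda>L. \<integral>z. F z \<partial>L) ` lifts)"
      unfolding psi_def lifts_def set_lebesgue_integral_def F_def by (intro arg_cong[of _ _ Inf]) blast
    have lower: "s - e \<le> (\<integral>z. F z \<partial>L)" if "L \<in> lifts" for L
    proof -
      have L: "L \<in> inv_measures shift2 (X \<times> Y)" and L\<nu>: "distr L borel snd = \<nu>" using that by (auto simp: lifts_def)
      interpret L: prob_space L by (rule inv_measuresD(3)[OF L])
      note [measurable_cong, simp] = inv_measuresD(1)[OF L]
      have snd: "snd \<in> L \<rightarrow>\<^sub>M borel" by measurable
      have Fi: "integrable L (\<lambda>z. F ((shift2 ^^ i) z))" for i
        by (rule L.integrable_const_bound[of _ "\<bar>B\<bar>"]) (use FB in auto)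
      have ci: "integrable L (\<lambda>z. c (cyl N (snd z)))"
        using integrable_distr[OF snd, of "\<lambda>y. c (cyl N y)"] step(1) L\<nu> by simp
      have "n * (s - e) \<le> n * (s - 2 * (e/3))" using e n by simp
      also have "\<dots> = n * ((\<integral>z. c (cyl N (snd z)) \<partial>L) - 2 * (e/3))"
        using integral_distr[OF snd stepm] step(2) L\<nu> by simp
      also have "\<dots> = (\<integral>z. n * (c (cyl N (snd z)) - 2 * (e/3)) \<partial>L)"
        using ci by (simp add: L.prob_space)
      also have "\<dots> \<le> (\<integral>z. (\<Sum>i<n. F ((shift2 ^^ i) z)) \<partial>L)"
      proof (rule integral_mono_AE)
        show "integrable L (\<lambda>z. n * (c (cyl N (snd z)) - 2 * (e/3)))" using ci by simp
        show "integrable L (\<lambda>z. \<Sum>i<n. F ((shift2 ^^ i) z))" using Fi by simp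
        have "AE z in L. z \<in> X \<times> Y"
          using inv_measuresD(4)[OF L] by (intro L.AE_prob_1) (simp add: measure_def)
        then show "AE z in L. n * (c (cyl N (snd z)) - 2 * (e/3)) \<le> (\<Sum>i<n. F ((shift2 ^^ i) z))"
        proof eventually_elim
          fix z assume "z \<in> X \<times> Y"
          then show "n * (c (cyl N (snd z)) - 2 * (e/3)) \<le> (\<Sum>i<n. F ((shift2 ^^ i) z))"
            using lo Ff by (cases z) auto
        qed
      qed
      also have "\<dots> = (\<Sum>i<n. \<integral>z. F ((shift2 ^^ i) z) \<partial>L)" using Fi by simp
      also have "\<dots> = n * (\<integral>z. F z \<partial>L)"
        by (simp add: integral_funpow_invariant[OF L borel_measurable_shift2 F])
      finally show ?thesis using n by simp
    qed
    obtain L where L: "L \<in> lifts" "(\<integral>z. F z \<partial>L) \<le> s + e"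
    proof -
      define h where "h y = (G y, y)" for y
      have h [measurable]: "h \<in> borel \<rightarrow>\<^sub>M borel"
        unfolding h_def by (intro borel_measurable_continuous_onI continuous_intros G(1))
      define m where "m = distr \<nu> borel h"
      have h\<nu>: "h \<in> \<nu> \<rightarrow>\<^sub>M borel" by measurable
      have m: "sets m = sets borel" "space m = UNIV" "prob_space m"
        unfolding m_def using \<nu>.prob_space_distr[OF h\<nu>] by auto
      have shn: "shift ^^ i \<in> borel \<rightarrow>\<^sub>M (borel :: (int \<Rightarrow> 'b) measure)" for i
        by (rule measurable_funpow[OF borel_measurable_shift])
      have shn\<nu>: "distr \<nu> borel (shift ^^ i) = \<nu>" for i
      proof (rule measure_eqI)
        fix A assume A: "A \<in> sets (distr \<nu> borel (shift ^^ i))"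
        have "emeasure \<nu> ((shift ^^ i) -` A) = emeasure \<nu> A"
        proof (induction i)
          case (Suc i)
          have "(shift ^^ i) -` A \<in> sets borel" using measurable_sets[OF shn, of A i] A by simp
          from inv_measures_vimage[OF \<nu> borel_measurable_shift this] Suc
          show ?case by (simp add: vimage_def funpow_swap1)
        qed simp
        then show "emeasure (distr \<nu> borel (shift ^^ i)) A = emeasure \<nu> A"
          using A shn[of i] by (simp add: emeasure_distr)
      qed simp
      \<comment> \<open>The graph map of G intertwines the n-th powers of the two shifts, so the
        image m of \<open>\<nu>\<close> is invariant under n steps.\<close>
      have "(shift2 ^^ n) (h y) = h ((shift ^^ n) y)" for y by (simp add: h_def shift2_funpow G(3))
      then have "distr m borel (shift2 ^^ n) = distr (distr \<nu> borel (shift ^^ n)) borel h"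
        unfolding m_def using h shn[of n] by (simp add: distr_distr comp_def)
      then have inv: "distr m borel (shift2 ^^ n) = m" by (simp add: shn\<nu> m_def)
      obtain L where L: "sets L = sets borel" "prob_space L" "distr L borel shift2 = L"
        "\<And>A. A \<in> sets borel \<Longrightarrow> measure L A = (\<Sum>i<n. measure m ((shift2 ^^ i) -` A)) / n"
        "\<And>F B. F \<in> borel_measurable borel \<Longrightarrow> (\<And>z. \<bar>F z\<bar> \<le> B) \<Longrightarrow>
           (\<integral>z. F z \<partial>L) = (\<Sum>i<n. \<integral>z. F ((shift2 ^^ i) z) \<partial>m) / n"
        using average_measure[OF m(1,3) borel_measurable_shift2 n inv] by blast
      interpret L: prob_space L by fact
      note [measurable_cong, simp] = L(1)
      have sL: "space L = UNIV" using sets_eq_imp_space_eq[OF L(1)] by simp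
      have mm: "measure m ((shift2 ^^ i) -` A) = measure \<nu> {y. ((shift ^^ i) (G y), (shift ^^ i) y) \<in> A}"
        if "A \<in> sets borel" for A i
      proof -
        have "(shift2 ^^ i) -` A \<in> sets borel" using measurable_sets[OF T that, of i] by simp
        then show ?thesis using h\<nu> by (simp add: m_def measure_distr vimage_def h_def shift2_funpow)
      qed
      have Y1: "measure \<nu> Y = 1" using inv_measuresD(4)[OF \<nu>] by (simp add: measure_def)
      have "measure \<nu> {y. ((shift ^^ i) (G y), (shift ^^ i) y) \<in> X \<times> Y} = 1" for i
      proof -
        have "(shift ^^ i) y \<in> Y \<longleftrightarrow> y \<in> Y" for y
          by (induction i) (auto simp: shift_mem_iff[OF sY])
        then have "{y. ((shift ^^ i) (G y), (shift ^^ i) y) \<in> X \<times> Y} = Y"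
          using shift_funpow_mem[OF sX G(2)] by auto
        then show ?thesis using Y1 by simp
      qed
      then have "measure L (X \<times> Y) = 1" using L(4)[OF XYb] mm[OF XYb] n by simp
      then have Linv: "L \<in> inv_measures shift2 (X \<times> Y)"
        using L by (simp add: inv_measures_def L.emeasure_eq_measure)
      moreover have "distr L borel snd = \<nu>"
      proof (rule measure_eqI)
        fix A assume "A \<in> sets (distr L borel snd)"
        then have A: "A \<in> sets borel" by simp
        have sA: "snd -` A \<in> sets (borel :: ((int \<Rightarrow> 'a) \<times> (int \<Rightarrow> 'b)) measure)"
          using measurable_sets[OF borel_measurable_snd A] by simp
        \<comment> \<open>The second coordinate is only moved by powers of the shift, so each term
          of the average has second marginal \<open>\<nu>\<close>.\<close>
        have "measure \<nu> {y. (shift ^^ i) y \<in> A} = measure \<nu> A" for i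
          using arg_cong[OF shn\<nu>[of i], of "\<lambda>M. measure M A"] A shn[of i] by (simp add: measure_distr vimage_def)
        then have "measure L (snd -` A) = measure \<nu> A"
          using L(4)[OF sA] mm[OF sA] n by simp
        moreover have "snd \<in> L \<rightarrow>\<^sub>M borel" by measurable
        ultimately show "emeasure (distr L borel snd) A = emeasure \<nu> A"
          using A by (simp add: emeasure_distr sL L.emeasure_eq_measure \<nu>.emeasure_eq_measure)
      qed simp
      moreover have "(\<integral>z. F z \<partial>L) \<le> s + e"
      proof -
        have Fi: "integrable \<nu> (\<lambda>y. F ((shift2 ^^ i) (h y)))" for i
          by (rule \<nu>.integrable_const_bound[of _ "\<bar>B\<bar>"]) (use FB in auto)
        have Fm: "(\<lambda>z. F ((shift2 ^^ i) z)) \<in> borel_measurable borel" for i by measurable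
        have "n * (\<integral>z. F z \<partial>L) = (\<Sum>i<n. \<integral>z. F ((shift2 ^^ i) z) \<partial>m)"
          using L(5)[OF F FB] n by simp
        also have "\<dots> = (\<Sum>i<n. \<integral>y. F ((shift2 ^^ i) (h y)) \<partial>\<nu>)"
          unfolding m_def by (simp add: integral_distr[OF h\<nu> Fm])
        also have "\<dots> = (\<integral>y. (\<Sum>i<n. F ((shift2 ^^ i) (h y))) \<partial>\<nu>)" using Fi by simp
        also have "\<dots> \<le> (\<integral>y. n * (c (cyl N y) + 3 * (e/3)) \<partial>\<nu>)"
        proof (rule integral_mono_AE)
          show "integrable \<nu> (\<lambda>y. \<Sum>i<n. F ((shift2 ^^ i) (h y)))" using Fi by simp
          show "integrable \<nu> (\<lambda>y. n * (c (cyl N y) + 3 * (e/3)))" using step(1) by simp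
          have "AE y in \<nu>. y \<in> Y" by (intro \<nu>.AE_prob_1 Y1)
          then show "AE y in \<nu>. (\<Sum>i<n. F ((shift2 ^^ i) (h y))) \<le> n * (c (cyl N y) + 3 * (e/3))"
            by eventually_elim (use up Ff G(2) in \<open>simp add: h_def\<close>)
        qed
        also have "\<dots> = n * (s + e)" using step \<nu>.prob_space by simp
        finally show ?thesis using n by simp
      qed
      ultimately show thesis by (intro that[of L]) (simp_all add: lifts_def)
    qed
    \<comment> \<open>The bound valid for all lifts and the one constructed lift make the infimum
      one over a nonempty set bounded below, and confine it to the interval from s - e to s +
      e.\<close>
    have "bdd_below ((\<lambda>L. \<integral>z. F z \<partial>L) ` lifts)" using lower by (intro bdd_belowI[of _ "s - e"]) auto
    then have "psi f X Y \<nu> \<le> (\<integral>z. F z \<partial>L)" unfolding psi by (intro cInf_lower imageI L(1))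
    moreover have "s - e \<le> psi f X Y \<nu>" unfolding psi by (rule cInf_greatest) (use L(1) lower in auto)
    ultimately show "\<bar>psi f X Y \<nu> - (\<Sum>C\<in>range (cyl N). c C * measure \<nu> C)\<bar> \<le> e"
      using L(2) by (simp add: s_def[symmetric] abs_le_iff)
  qed
qed

subsection \<open>Continuity, affinity and an ergodic maximiser\<close>

text \<open>The indicator of a clopen set is continuous, so integrating it is continuous by
  definition of the weak* topology. Restricting the integral to Y changes nothing for measures
  concentrated on Y.\<close>

lemma continuous_map_measure_clopen:
  assumes "clopen C" and Y: "closed Y"
  shows "continuous_map (subtopology (weakstar Y) (inv_measures S Y)) euclideanreal (\<lambda>\<nu>. measure \<nu> C)"
proof -
  let ?\<T> = "{{M. (\<integral>x\<in>Y. g x \<partial>M) \<in> U} | (g :: 'a \<Rightarrow> real) U. continuous_on Y g \<and> open U}"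
  let ?g = "indicator C :: 'a \<Rightarrow> real"
  have g: "continuous_on Y ?g"
  proof -
    have "continuous_on (C \<union> - C) ?g"
      using assms(1) by (intro continuous_on_closed_Un) (auto simp: clopen_def closed_Compl
          intro: continuous_on_cong[THEN iffD2, OF refl _ continuous_on_const, of C _ 1]
            continuous_on_cong[THEN iffD2, OF refl _ continuous_on_const, of "- C" _ 0])
    then show ?thesis by (rule continuous_on_subset) auto
  qed
  \<comment> \<open>Taking the whole real line as target set shows that the set of all measures is
    itself a generator.\<close>
  have top: "topspace (weakstar Y) = UNIV"
  proof -
    have "UNIV \<in> ?\<T>" by (rule CollectI, rule exI[of _ ?g], rule exI[of _ UNIV]) (simp add: g)
    then show ?thesis unfolding weakstar_def topology_generated_by_topspace by blast
  qed
  have "continuous_map (weakstar Y) euclideanreal (\<lambda>\<nu>. \<integral>x\<in>Y. ?g x \<partial>\<nu>)"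
    unfolding continuous_map_def
  proof (intro conjI allI impI)
    fix U :: "real set" assume "openin euclidean U"
    then have "{M. (\<integral>x\<in>Y. ?g x \<partial>M) \<in> U} \<in> ?\<T>" using g by auto
    then show "openin (weakstar Y) {\<nu> \<in> topspace (weakstar Y). (\<integral>x\<in>Y. ?g x \<partial>\<nu>) \<in> U}"
      unfolding top unfolding weakstar_def by (simp add: topology_generated_by_Basis)
  qed (simp add: top)
  then have "continuous_map (subtopology (weakstar Y) (inv_measures S Y)) euclideanreal (\<lambda>\<nu>. \<integral>x\<in>Y. ?g x \<partial>\<nu>)"
    by (rule continuous_map_from_subtopology)
  moreover have "(\<integral>x\<in>Y. ?g x \<partial>\<nu>) = measure \<nu> C" if \<nu>: "\<nu> \<in> inv_measures S Y" for \<nu>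
  proof -
    interpret prob_space \<nu> by (rule inv_measuresD(3)[OF \<nu>])
    note [simp] = inv_measuresD(1,2)[OF \<nu>]
    have "(\<integral>x\<in>Y. ?g x \<partial>\<nu>) = (\<integral>x. indicator (Y \<inter> C) x \<partial>\<nu>)"
      unfolding set_lebesgue_integral_def
      by (intro Bochner_Integration.integral_cong) (auto simp: indicator_def)
    also have "\<dots> = prob (C \<inter> Y)" by (simp add: Int_commute)
    also have "\<dots> = prob C"
    proof (rule measure_eq_AE)
      have "AE x in \<nu>. x \<in> Y" using inv_measuresD(4)[OF \<nu>] by (intro AE_prob_1) (simp add: measure_def)
      then show "AE x in \<nu>. x \<in> C \<inter> Y \<longleftrightarrow> x \<in> C" by eventually_elim auto
    qed (use assms in auto)
    finally show ?thesis .
  qed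
  ultimately show ?thesis by (rule continuous_map_eq) auto
qed

lemma continuous_map_approximable:
  fixes g :: "'x \<Rightarrow> real"
  assumes "\<And>e. 0 < e \<Longrightarrow> \<exists>h. continuous_map T euclideanreal h \<and> (\<forall>x\<in>topspace T. \<bar>g x - h x\<bar> \<le> e)"
  shows "continuous_map T euclideanreal g"
proof -
  have "\<exists>h. \<forall>n::nat. continuous_map T euclideanreal (h n) \<and> (\<forall>x\<in>topspace T. \<bar>g x - h n x\<bar> \<le> inverse (Suc n))"
    using assms by (intro choice allI) simp
  then obtain h where h: "\<And>n::nat. continuous_map T euclideanreal (h n)"
    "\<And>n x. x \<in> topspace T \<Longrightarrow> \<bar>g x - h n x\<bar> \<le> inverse (Suc n)" by blast
  show ?thesis
    unfolding mtopology_is_euclidean[symmetric]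
  proof (rule Met_TC.continuous_map_uniform_limit[where F = sequentially and f = h])
    fix e :: real assume "0 < e"
    then have "eventually (\<lambda>n. inverse (real (Suc n)) < e) sequentially"
      by (rule order_tendstoD(2)[OF LIMSEQ_inverse_real_of_nat])
    then show "eventually (\<lambda>n. \<forall>x\<in>topspace T. g x \<in> UNIV \<and> dist (h n x) (g x) < e) sequentially"
    proof eventually_elim
      case (elim n)
      then show ?case using h(2)[of _ n] by (fastforce simp: dist_real_def abs_minus_commute intro: le_less_trans)
    qed
  qed (use h(1) in auto)
qed

theorem theorem3p9:
  fixes X :: "(int \<Rightarrow> 'a::{finite,discrete_topology}) set"
    and Y :: "(int \<Rightarrow> 'b::{finite,discrete_topology}) set"
    and f :: "(int \<Rightarrow> 'a) \<times> (int \<Rightarrow> 'b) \<Rightarrow> real"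
  assumes "is_shift X" and "is_shift Y"
    and "is_sft X" and "is_transitive X"
    and "continuous_on (X \<times> Y) f"
  shows "continuous_map (subtopology (weakstar Y) (inv_measures shift Y)) euclideanreal (psi f X Y)
       \<and> affine_on_measures (inv_measures shift Y) (psi f X Y)
       \<and> (\<exists>\<nu>0. extreme_measure (inv_measures shift Y) \<nu>0 \<and>
              psi f X Y \<nu>0 = (SUP \<nu>\<in>inv_measures shift Y. psi f X Y \<nu>))"
proof -
  let ?P = "inv_measures shift Y" and ?\<psi> = "psi f X Y"
  have Y: "Y \<noteq> {}" "closed Y" "shift ` Y = Y"
    using assms(2) by (auto simp: is_shift_def closed_of_compact_fun)
  have approx: "\<exists>N c. \<forall>\<nu>\<in>?P. \<bar>?\<psi> \<nu> - (\<Sum>C\<in>range (cyl N). c C * measure \<nu> C)\<bar> \<le> e" if "0 < e" for e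
    using psi_approximation[OF assms that] by metis
  have cyl: "clopen C" if "C \<in> range (cyl N)" for C :: "(int \<Rightarrow> 'b) set" and N
    using that by (auto intro: clopen_cylinder cyl_in_cylinders)
  have cont: "continuous_map (subtopology (weakstar Y) ?P) euclideanreal ?\<psi>"
  proof (rule continuous_map_approximable)
    fix e :: real assume "0 < e"
    then obtain N c where Nc: "\<forall>\<nu>\<in>?P. \<bar>?\<psi> \<nu> - (\<Sum>C\<in>range (cyl N). c C * measure \<nu> C)\<bar> \<le> e"
      using approx by blast
    have "continuous_map (subtopology (weakstar Y) ?P) euclideanreal
        (\<lambda>\<nu>. \<Sum>C\<in>range (cyl N). c C * measure \<nu> C)"
      by (intro continuous_map_sum finite_range_cyl continuous_map_real_mult_left
          continuous_map_measure_clopen[OF cyl Y(2)])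
    then show "\<exists>h. continuous_map (subtopology (weakstar Y) ?P) euclideanreal h \<and>
        (\<forall>\<nu>\<in>topspace (subtopology (weakstar Y) ?P). \<bar>?\<psi> \<nu> - h \<nu>\<bar> \<le> e)"
      using Nc by (intro exI[of _ "\<lambda>\<nu>. \<Sum>C\<in>range (cyl N). c C * measure \<nu> C"]) auto
  qed
  have mixP: "mix t \<mu> \<nu> \<in> ?P" if "\<mu> \<in> ?P" "\<nu> \<in> ?P" "t \<in> {0..1}" for \<mu> \<nu> t
    using that Y(2) by (intro mix_in_inv_measures) auto
  have mix_measure: "measure (mix t \<mu> \<nu>) C = t * measure \<mu> C + (1 - t) * measure \<nu> C"
    if "\<mu> \<in> ?P" "\<nu> \<in> ?P" "t \<in> {0..1}" "clopen C" for \<mu> \<nu> t C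
    using that(3,4) by (intro measure_mix inv_measuresD(1,3)[OF that(1)] inv_measuresD(1,3)[OF that(2)]) auto
  have aff: "?\<psi> (mix t \<mu> \<nu>) = t * ?\<psi> \<mu> + (1 - t) * ?\<psi> \<nu>"
    if \<mu>: "\<mu> \<in> ?P" and \<nu>: "\<nu> \<in> ?P" and t: "t \<in> {0..1}" for \<mu> \<nu> t
  proof -
    have "\<bar>?\<psi> (mix t \<mu> \<nu>) - (t * ?\<psi> \<mu> + (1 - t) * ?\<psi> \<nu>)\<bar> \<le> 0 + e" if e: "0 < e" for e
    proof -
      \<comment> \<open>Three approximation errors enter, with weights 1, t and 1 - t; these add up
        to 2.\<close>
      obtain N c where Nc: "\<forall>\<nu>\<in>?P. \<bar>?\<psi> \<nu> - (\<Sum>C\<in>range (cyl N). c C * measure \<nu> C)\<bar> \<le> e / 2"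
        using approx[of "e / 2"] e by auto
      define I where "I \<nu> = (\<Sum>C\<in>range (cyl N). c C * measure \<nu> C)" for \<nu>
      have "I (mix t \<mu> \<nu>) = (\<Sum>C\<in>range (cyl N). t * (c C * measure \<mu> C) + (1 - t) * (c C * measure \<nu> C))"
        unfolding I_def
      proof (intro sum.cong refl)
        fix C :: "(int \<Rightarrow> 'b) set" assume "C \<in> range (cyl N)"
        then have "clopen C" by (rule cyl)
        then show "c C * measure (mix t \<mu> \<nu>) C = t * (c C * measure \<mu> C) + (1 - t) * (c C * measure \<nu> C)"
          by (simp add: mix_measure[OF \<mu> \<nu> t] algebra_simps)
      qed
      also have "\<dots> = t * I \<mu> + (1 - t) * I \<nu>"
        by (simp add: I_def sum.distrib sum_distrib_left)
      finally have "?\<psi> (mix t \<mu> \<nu>) - (t * ?\<psi> \<mu> + (1 - t) * ?\<psi> \<nu>) =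
          (?\<psi> (mix t \<mu> \<nu>) - I (mix t \<mu> \<nu>)) - t * (?\<psi> \<mu> - I \<mu>) - (1 - t) * (?\<psi> \<nu> - I \<nu>)"
        by (simp add: algebra_simps)
      also have "\<bar>\<dots>\<bar> \<le> \<bar>?\<psi> (mix t \<mu> \<nu>) - I (mix t \<mu> \<nu>)\<bar> + \<bar>t * (?\<psi> \<mu> - I \<mu>)\<bar> + \<bar>(1 - t) * (?\<psi> \<nu> - I \<nu>)\<bar>"
        by linarith
      also have "\<dots> \<le> e / 2 + t * (e / 2) + (1 - t) * (e / 2)"
        using Nc \<mu> \<nu> t mixP[OF \<mu> \<nu> t] unfolding I_def abs_mult
        by (intro add_mono mult_mono) auto
      also have "\<dots> = 0 + e" by (simp add: field_simps)
      finally show ?thesis .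
    qed
    then have "\<bar>?\<psi> (mix t \<mu> \<nu>) - (t * ?\<psi> \<mu> + (1 - t) * ?\<psi> \<nu>)\<bar> \<le> 0"
      by (rule field_le_epsilon)
    then show ?thesis by simp
  qed
  let ?e = "clopen_content :: (int \<Rightarrow> 'b) measure \<Rightarrow> _" and ?Q = "inv_contents Y"
  have img: "?e ` ?P = ?Q" by (rule clopen_content_image[OF Y(2)])
  have cyl_e: "?e \<nu> C = measure \<nu> C" if "C \<in> cylinders" for \<nu> C
    using clopen_cylinder[OF that] by (simp add: clopen_content_def)
  have eq: "\<mu> = \<nu>" if \<mu>: "\<mu> \<in> ?P" and \<nu>: "\<nu> \<in> ?P" and "\<And>C. C \<in> cylinders \<Longrightarrow> ?e \<mu> C = ?e \<nu> C" for \<mu> \<nu>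
    using that(3) cyl_e
    by (intro measure_eqI_cylinders inv_measuresD(1,3)[OF \<mu>] inv_measuresD(1,3)[OF \<nu>]) simp
  then have inj: "inj_on ?e ?P" by (auto intro: inj_onI)
  \<comment> \<open>\<open>psi\<close> is transported to the compact space of contents. It is
    continuous there by the same approximants, each of which reads finitely many coordinates of
    q.\<close>
  define \<Psi> where "\<Psi> q = ?\<psi> (the_inv_into ?P ?e q)" for q
  have \<Psi>: "\<Psi> (?e \<nu>) = ?\<psi> \<nu>" if "\<nu> \<in> ?P" for \<nu>
    using that by (simp add: \<Psi>_def the_inv_into_f_f[OF inj])
  have cont\<Psi>: "continuous_on ?Q \<Psi>"
  proof -
    have "continuous_map (top_of_set ?Q) euclideanreal \<Psi>"
    proof (rule continuous_map_approximable)
      fix e :: real assume "0 < e"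
      then obtain N c where Nc: "\<forall>\<nu>\<in>?P. \<bar>?\<psi> \<nu> - (\<Sum>C\<in>range (cyl N). c C * measure \<nu> C)\<bar> \<le> e"
        using approx by blast
      have "continuous_on ?Q (\<lambda>q. \<Sum>C\<in>range (cyl N). c C * q C)"
        by (intro continuous_intros continuous_on_subset[OF continuous_on_product_coordinates]) auto
      moreover have "\<bar>\<Psi> q - (\<Sum>C\<in>range (cyl N). c C * q C)\<bar> \<le> e" if q: "q \<in> ?Q" for q
      proof -
        obtain \<nu> where \<nu>: "\<nu> \<in> ?P" "q = ?e \<nu>" using q unfolding img[symmetric] by auto
        have "(\<Sum>C\<in>range (cyl N). c C * q C) = (\<Sum>C\<in>range (cyl N). c C * measure \<nu> C)"
          using cyl by (intro sum.cong refl) (simp add: \<nu>(2) clopen_content_def)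
        then show ?thesis using Nc \<nu> \<Psi> by simp
      qed
      ultimately show "\<exists>h. continuous_map (top_of_set ?Q) euclideanreal h \<and>
          (\<forall>q\<in>topspace (top_of_set ?Q). \<bar>\<Psi> q - h q\<bar> \<le> e)"
        by (intro exI[of _ "\<lambda>q. \<Sum>C\<in>range (cyl N). c C * q C"]) simp
    qed
    then show ?thesis by simp
  qed
  define C where "C = from_nat_into (cylinders :: (int \<Rightarrow> 'b) set set)"
  have C: "range C = cylinders"
    unfolding C_def using countable_cylinders cyl_in_cylinders by (intro range_from_nat_into) auto
  \<comment> \<open>Index 0 makes the point found a maximiser of \<open>psi\<close>; the remaining
    indices run through the cylinders, whose values separate measures.\<close>
  define \<phi> where "\<phi> n q = (case n of 0 \<Rightarrow> \<Psi> q | Suc k \<Rightarrow> q (C k))" for n and q :: "(int \<Rightarrow> 'b) set \<Rightarrow> real"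
  have "continuous_on ?Q (\<phi> n)" for n
    using cont\<Psi> by (cases n) (auto simp: \<phi>_def intro: continuous_on_subset[OF continuous_on_product_coordinates])
  from lexicographic_maximum[of ?Q \<phi>, OF compact_inv_contents closed_inv_contents inv_contents_nonempty[OF Y(1,3)] this]
  obtain q where q: "q \<in> ?Q" "\<And>r. r \<in> ?Q \<Longrightarrow> \<phi> 0 r \<le> \<phi> 0 q"
    "\<And>a b t n. a \<in> ?Q \<Longrightarrow> b \<in> ?Q \<Longrightarrow> 0 < t \<Longrightarrow> t < 1 \<Longrightarrow>
       (\<And>n. \<phi> n q = t * \<phi> n a + (1 - t) * \<phi> n b) \<Longrightarrow> \<phi> n a = \<phi> n q \<and> \<phi> n b = \<phi> n q"
    by blast
  obtain \<nu>0 where \<nu>0: "\<nu>0 \<in> ?P" "q = ?e \<nu>0" using q(1) unfolding img[symmetric] by auto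
  have "?\<psi> \<nu> \<le> ?\<psi> \<nu>0" if "\<nu> \<in> ?P" for \<nu>
    using q(2)[of "?e \<nu>"] imageI[OF that, of ?e] that \<nu>0 \<Psi> by (simp add: \<phi>_def img)
  then have sup: "?\<psi> \<nu>0 = (SUP \<nu>\<in>?P. ?\<psi> \<nu>)"
    using \<nu>0(1) by (intro cSup_eq_maximum[symmetric]) auto
  have "\<mu>1 = \<nu>0 \<and> \<mu>2 = \<nu>0"
    if \<mu>: "\<mu>1 \<in> ?P" "\<mu>2 \<in> ?P" and t: "t \<in> {0<..<1}" and m: "\<nu>0 = mix t \<mu>1 \<mu>2" for \<mu>1 \<mu>2 t
  proof -
    have t': "0 < t" "t < 1" "t \<in> {0..1}" using t by auto
    have Q: "?e \<mu>1 \<in> ?Q" "?e \<mu>2 \<in> ?Q" using \<mu> unfolding img[symmetric] by auto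
    \<comment> \<open>Affinity of \<open>psi\<close> enters here, at index 0: without it the
      maximisers need not form a face.\<close>
    have conv: "\<phi> n q = t * \<phi> n (?e \<mu>1) + (1 - t) * \<phi> n (?e \<mu>2)" for n
    proof (cases n)
      case 0
      then show ?thesis using aff[OF \<mu> t'(3)] \<Psi> \<mu> \<nu>0 m by (simp add: \<phi>_def)
    next
      case (Suc k)
      have "C k \<in> cylinders" using C by blast
      then show ?thesis using Suc mix_measure[OF \<mu> t'(3) clopen_cylinder, of "C k"] m \<nu>0(2)
        by (simp add: \<phi>_def cyl_e)
    qed
    have coord: "?e \<mu>1 D = q D \<and> ?e \<mu>2 D = q D" if D: "D \<in> cylinders" for D
    proof -
      obtain k where "D = C k" using D unfolding C[symmetric] by auto
      then show ?thesis using q(3)[OF Q t'(1,2) conv, of "Suc k"] by (simp add: \<phi>_def)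
    qed
    show ?thesis
      using eq[OF \<mu>(1) \<nu>0(1)] eq[OF \<mu>(2) \<nu>0(1)] coord \<nu>0(2) by simp
  qed
  then have "extreme_measure ?P \<nu>0" using \<nu>0(1) by (simp add: extreme_measure_def)
  moreover have "affine_on_measures ?P ?\<psi>" using aff by (simp add: affine_on_measures_def)
  ultimately show ?thesis using cont sup by blast
qed

end
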